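(* Let $\mathcal{E}_t=e^{tL}$, $t\ge0$, be a quantum process on a finite-dimensional system S generated by a Lindblad operator $L$. Then the equation $$\mathcal{E}_t[\rho]=\mathrm{tr}_{\mathrm E}\left[e^{-\mathrm{i}Ht}\,(\rho\otimes\rho_{\mathrm E})\,e^{\mathrm{i}Ht}\right]\qquad\text{for all density matrices }\rho\text{ of S and all }t\ge0$$ holds for some finite-dimensional environment E, some density matrix $\rho_{\mathrm E}$ of E and some Hamiltonian (hermitian operator) $H$ of finite dimension on $\mathcal{H}_{\mathrm S}\otimes\mathcal{H}_{\mathrm E}$ if and only if $\mathcal{E}_t$ is a unitary conjugation for every $t$.
   Context: A Lindblad operator (generator) is a linear map $L[\rho]=\mathrm{i}[\rho,H_0]+\sum_{i,j}G_{ij}\left(F_i\rho F_j^\dagger-\tfrac12\{F_j^\dagger F_i,\rho\}\right)$ with $H_0$, $G$ hermitian, $G\ge0$, and $F_i$ operators on the system Hilbert space $\mathcal{H}_{\mathrm S}$. $\mathrm{tr}_{\mathrm E}$ is the partial trace over $\mathcal{H}_{\mathrm E}$. A unitary conjugation is a map $\rho\mapsto U\rho U^\dagger$ with $U$ unitary. *)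

theory Defs
  imports Complex_Main "Jordan_Normal_Form.Schur_Decomposition"
begin

text \<open>Operators on an \<open>n\<close>-dimensional Hilbert space are the matrices in \<open>carrier_mat n n\<close>
  over \<open>complex\<close>; \<open>mat_adjoint\<close> is the conjugate transpose.\<close>

definition hermitian_mat :: "nat \<Rightarrow> complex mat \<Rightarrow> bool" where
  "hermitian_mat n A \<longleftrightarrow> A \<in> carrier_mat n n \<and> mat_adjoint A = A"

text \<open>The order on \<open>complex\<close> is the partial one: \<open>0 \<le> z\<close> means that \<open>z\<close> is real and
  nonnegative.\<close>

definition psd_mat :: "nat \<Rightarrow> complex mat \<Rightarrow> bool" where
  "psd_mat n A \<longleftrightarrow> hermitian_mat n A \<and> (\<forall>v\<in>carrier_vec n. 0 \<le> (A *\<^sub>v v) \<bullet>c v)"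

definition unitary_mat :: "nat \<Rightarrow> complex mat \<Rightarrow> bool" where
  "unitary_mat n U \<longleftrightarrow>
     U \<in> carrier_mat n n \<and> U * mat_adjoint U = 1\<^sub>m n \<and> mat_adjoint U * U = 1\<^sub>m n"

definition mat_trace :: "complex mat \<Rightarrow> complex" where
  "mat_trace A = (\<Sum>i<dim_row A. A $$ (i, i))"

definition density_mat :: "nat \<Rightarrow> complex mat \<Rightarrow> bool" where
  "density_mat n \<rho> \<longleftrightarrow> psd_mat n \<rho> \<and> mat_trace \<rho> = 1"

text \<open>The product basis vector \<open>e\<^sub>a \<otimes> f\<^sub>k\<close> of an \<open>n\<close>-dimensional and a \<open>d\<close>-dimensional space
  has index \<open>a * d + k\<close>.\<close>

definition tensor_mat :: "complex mat \<Rightarrow> complex mat \<Rightarrow> complex mat" where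
  "tensor_mat A B = mat (dim_row A * dim_row B) (dim_col A * dim_col B)
     (\<lambda>(i, j). A $$ (i div dim_row B, j div dim_col B) * B $$ (i mod dim_row B, j mod dim_col B))"

definition partial_trace_env :: "nat \<Rightarrow> nat \<Rightarrow> complex mat \<Rightarrow> complex mat" where
  "partial_trace_env n d M = mat n n (\<lambda>(a, b). \<Sum>k<d. M $$ (a * d + k, b * d + k))"

text \<open>Matrices form no topological vector space type here, so the two exponential series are
  taken entrywise. They converge absolutely for every square matrix and every linear map on
  \<open>carrier_mat n n\<close>.\<close>

definition mat_exp :: "complex mat \<Rightarrow> complex mat" where
  "mat_exp A = mat (dim_row A) (dim_row A) (\<lambda>ij. \<Sum>k. (A ^\<^sub>m k) $$ ij / fact k)"

definition superop_exp :: "nat \<Rightarrow> (complex mat \<Rightarrow> complex mat) \<Rightarrow> complex mat \<Rightarrow> complex mat" where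
  "superop_exp n \<Phi> \<rho> = mat n n (\<lambda>ij. \<Sum>k. ((\<Phi> ^^ k) \<rho>) $$ ij / fact k)"

definition quantum_process ::
    "nat \<Rightarrow> (complex mat \<Rightarrow> complex mat) \<Rightarrow> real \<Rightarrow> complex mat \<Rightarrow> complex mat" where
  "quantum_process n L t = superop_exp n (\<lambda>X. complex_of_real t \<cdot>\<^sub>m L X)"

text \<open>The double sum over \<open>i\<close> and \<open>j\<close> is written entrywise, because the type of matrices of
  unspecified size has no zero.\<close>

definition lindblad_form ::
    "nat \<Rightarrow> nat \<Rightarrow> complex mat \<Rightarrow> complex mat \<Rightarrow> (nat \<Rightarrow> complex mat) \<Rightarrow> complex mat \<Rightarrow> complex mat" where
  "lindblad_form n m H0 G F \<rho> =
     \<i> \<cdot>\<^sub>m (\<rho> * H0 - H0 * \<rho>) +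
     mat n n (\<lambda>ab. \<Sum>i<m. \<Sum>j<m.
       (G $$ (i, j) \<cdot>\<^sub>m (F i * \<rho> * mat_adjoint (F j) -
          (1/2) \<cdot>\<^sub>m (mat_adjoint (F j) * F i * \<rho> + \<rho> * (mat_adjoint (F j) * F i)))) $$ ab)"

definition lindblad_operator :: "nat \<Rightarrow> (complex mat \<Rightarrow> complex mat) \<Rightarrow> bool" where
  "lindblad_operator n L \<longleftrightarrow>
     (\<exists>m H0 G F. hermitian_mat n H0 \<and> psd_mat m G \<and> (\<forall>i<m. F i \<in> carrier_mat n n) \<and>
        (\<forall>\<rho>\<in>carrier_mat n n. L \<rho> = lindblad_form n m H0 G F \<rho>))"

definition unitary_conjugation :: "nat \<Rightarrow> (complex mat \<Rightarrow> complex mat) \<Rightarrow> bool" where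
  "unitary_conjugation n \<Phi> \<longleftrightarrow>
     (\<exists>U. unitary_mat n U \<and> (\<forall>\<rho>\<in>carrier_mat n n. \<Phi> \<rho> = U * \<rho> * mat_adjoint U))"

end

theory Submission
  imports Defs
begin

text \<open>For a Lindblad operator with Kraus operators \<open>F i\<close>, the trace of \<open>L\<close> as a linear map on
  matrices is \<open>- n\<close> times the sum over all entries \<open>(a, b)\<close> of the quadratic form of \<open>G\<close>
  evaluated at the \<open>(a, b)\<close> entries of the traceless parts of the \<open>F i\<close>. It is therefore real and
  nonpositive, and it vanishes only if the dissipator vanishes, that is, if \<open>L \<rho> = \<i> [\<rho>, H\<^sub>0]\<close>.
  Otherwise \<open>L\<close> has an eigenvector \<open>X\<close> whose eigenvalue \<open>z\<close> has negative real part, so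
  \<open>exp (t L) X = exp (t z) X\<close> decays. This is impossible if \<open>exp (t L)\<close> is a unitary conjugation,
  which preserves the Hilbert-Schmidt norm. It is also impossible if there is a finite-dimensional
  dilation: by the pigeonhole principle the unitaries \<open>exp (- \<i> q H)\<close> come arbitrarily close to the
  identity for integers \<open>q \<ge> 1\<close>, so \<open>exp (q z) X\<close> would come arbitrarily close to \<open>X\<close>.\<close>

text \<open>The decaying eigenvector need not be positive or even hermitian, while the dilation
  equation is assumed for density matrices only. Both sides are linear in the entries of the state,
  and rank-one states already determine a linear form, so the equation passes to all matrices.
  Linearity of \<open>L\<close> makes sense only on \<open>carrier_mat n n\<close>; it is recorded
  by a matrix \<open>M\<close> of \<open>L\<close> in the basis of matrix units, which also reduces
  the exponential of \<open>L\<close> to \<open>mat_exp\<close> and gives \<open>L\<close> a trace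
  and eigenvalues. The trace is the sum of the eigenvalues, so its sign yields a decaying
  eigenvector without any explicit construction. It also spares a normal form of the generator: the
  \<open>F i\<close> may have nonzero trace or be linearly dependent, \<open>G\<close> may be
  singular, and still the given \<open>H0\<close> needs no correction once the trace vanishes.
  Recurrence times must stay away from 0: unitaries at times tending to 0 also approach the
  identity, but contradict nothing. At times \<open>q \<ge> 1\<close> the decay factor is at most
  \<open>exp (Re z) < 1\<close>, uniformly in \<open>q\<close>.\<close>

section \<open>Entries of products and adjoints, and flattened index pairs\<close>

lemma mult_mat_index:
  fixes A B :: "complex mat"
  assumes "A \<in> carrier_mat n m" "B \<in> carrier_mat m k" "i < n" "j < k"
  shows "(A * B) $$ (i, j) = (\<Sum>l<m. A $$ (i, l) * B $$ (l, j))"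
  using assms by (simp add: scalar_prod_def atLeast0LessThan)

lemma mult_mat3_index:
  fixes A B C :: "complex mat"
  assumes "A \<in> carrier_mat n m" "B \<in> carrier_mat m k" "C \<in> carrier_mat k l" "i < n" "j < l"
  shows "(A * B * C) $$ (i, j) = (\<Sum>u<m. \<Sum>v<k. A $$ (i, u) * B $$ (u, v) * C $$ (v, j))"
proof -
  have "(A * B * C) $$ (i, j) = (\<Sum>v<k. (A * B) $$ (i, v) * C $$ (v, j))"
    using assms by (intro mult_mat_index[of _ n]) auto
  also have "\<dots> = (\<Sum>v<k. \<Sum>u<m. A $$ (i, u) * B $$ (u, v) * C $$ (v, j))"
    using assms by (intro sum.cong refl) (subst mult_mat_index[of _ n m], auto simp: sum_distrib_right)
  finally show ?thesis
    by (simp add: sum.swap[of _ "{..<k}"])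
qed

lemma mat_adjoint_carrier [simp]:
  fixes A :: "complex mat"
  shows "A \<in> carrier_mat n m \<Longrightarrow> mat_adjoint A \<in> carrier_mat m n"
  by (auto simp: mat_adjoint_def)

lemma mat_adjoint_index [simp]:
  fixes A :: "complex mat"
  assumes "i < dim_col A" "j < dim_row A"
  shows "mat_adjoint A $$ (i, j) = cnj (A $$ (j, i))"
  using assms by (simp add: mat_adjoint_def mat_of_rows_index)

lemma hermitian_mat_index:
  assumes "hermitian_mat n A" "i < n" "j < n"
  shows "cnj (A $$ (i, j)) = A $$ (j, i)"
  using assms mat_adjoint_index[of j A i] by (auto simp: hermitian_mat_def)

lemma sum_product_index:
  fixes f :: "nat \<Rightarrow> 'a::comm_monoid_add"
  shows "(\<Sum>p<n * d. f p) = (\<Sum>a<n. \<Sum>k<d. f (a * d + k))"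
proof -
  have "(\<Sum>p<n * d. f p) = (\<Sum>a<n. sum f {a * d..<a * d + d})"
    by (simp add: sum.nat_group)
  also have "\<dots> = (\<Sum>a<n. \<Sum>k<d. f (a * d + k))"
    by (rule sum.cong[OF refl], subst sum.atLeastLessThan_shift_0) (simp add: atLeast0LessThan)
  finally show ?thesis .
qed

lemma product_index_less:
  fixes a k n d :: nat
  assumes "a < n" "k < d"
  shows "a * d + k < n * d"
proof -
  have "a * d + k < Suc a * d" using assms by simp
  also have "\<dots> \<le> n * d" using assms by (intro mult_right_mono) auto
  finally show ?thesis .
qed

lemma product_index_eq_iff:
  fixes a b c k d :: nat
  assumes "k < d" "b < d"
  shows "a * d + k = c * d + b \<longleftrightarrow> a = c \<and> k = b"
proof
  assume *: "a * d + k = c * d + b"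
  have "a = (a * d + k) div d" "c = (c * d + b) div d" using assms by auto
  then show "a = c \<and> k = b" using * by auto
qed auto

lemma sum_delta_mult:
  fixes f :: "nat \<Rightarrow> complex"
  assumes "a < n"
  shows "(\<Sum>c<n. (if c = a then f c else 0)) = f a" "(\<Sum>c<n. (if a = c then f c else 0)) = f a"
  using assms by auto

section \<open>The exponential series\<close>

lemma pow_mat_entry_bound:
  fixes A :: "complex mat"
  assumes A: "A \<in> carrier_mat n n"
  shows "\<exists>c\<ge>0. \<forall>k. \<forall>i<n. \<forall>j<n. cmod ((A ^\<^sub>m k) $$ (i, j)) \<le> c ^ k"
proof -
  \<comment> \<open>The sum of all entries in modulus dominates every column sum, which is what the
    induction over \<open>k\<close> multiplies by.\<close>
  define M where "M = (\<Sum>j<n. \<Sum>i<n. cmod (A $$ (i, j)))"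
  have M0: "M \<ge> 0" unfolding M_def by (intro sum_nonneg) auto
  have col: "(\<Sum>l<n. cmod (A $$ (l, j))) \<le> M" if "j < n" for j
    unfolding M_def using that
    by (intro member_le_sum[of j "{..<n}" "\<lambda>j. \<Sum>i<n. cmod (A $$ (i, j))"]) (auto intro: sum_nonneg)
  have "cmod ((A ^\<^sub>m k) $$ (i, j)) \<le> M ^ k" if "i < n" "j < n" for i j k
    using that
  proof (induction k arbitrary: i j)
    case 0
    then show ?case using A by auto
  next
    case (Suc k)
    have "cmod ((A ^\<^sub>m Suc k) $$ (i, j)) = cmod (\<Sum>l<n. (A ^\<^sub>m k) $$ (i, l) * A $$ (l, j))"
      using A Suc.prems by (simp add: mult_mat_index[of _ n n _ n] del: index_mult_mat)
    also have "\<dots> \<le> (\<Sum>l<n. cmod ((A ^\<^sub>m k) $$ (i, l)) * cmod (A $$ (l, j)))"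
      by (intro order_trans[OF norm_sum]) (simp add: norm_mult)
    also have "\<dots> \<le> (\<Sum>l<n. M ^ k * cmod (A $$ (l, j)))"
      using Suc by (intro sum_mono mult_right_mono) auto
    also have "\<dots> \<le> M ^ k * M"
      using col[OF Suc.prems(2)] M0 by (simp add: sum_distrib_left[symmetric] mult_left_mono)
    finally show ?case by (simp add: mult.commute)
  qed
  then show ?thesis using M0 by blast
qed

lemma summable_norm_mat_exp:
  fixes A :: "complex mat"
  assumes A: "A \<in> carrier_mat n n" and ij: "i < n" "j < n"
  shows "summable (\<lambda>k. cmod ((A ^\<^sub>m k) $$ (i, j) / fact k))"
proof -
  obtain c where c: "c \<ge> 0" "\<And>k. cmod ((A ^\<^sub>m k) $$ (i, j)) \<le> c ^ k"
    using pow_mat_entry_bound[OF A] ij by blast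
  have "summable (\<lambda>k. c ^ k / fact k)"
    using summable_exp[of c] by (simp add: field_simps)
  then show ?thesis
    by (rule summable_comparison_test')
       (use c in \<open>auto simp: norm_divide intro!: divide_right_mono\<close>)
qed

lemma mat_exp_carrier [simp]: "A \<in> carrier_mat n n \<Longrightarrow> mat_exp A \<in> carrier_mat n n"
  by (simp add: mat_exp_def)

lemma mat_exp_sums:
  fixes A :: "complex mat"
  assumes A: "A \<in> carrier_mat n n" and ij: "i < n" "j < n"
  shows "(\<lambda>k. (A ^\<^sub>m k) $$ (i, j) / fact k) sums (mat_exp A $$ (i, j))"
  using summable_norm_cancel[OF summable_norm_mat_exp[OF A ij]] A ij
  by (simp add: mat_exp_def summable_sums)

text \<open>For fixed inner indices \<open>u\<close>, \<open>v\<close> the entry is a product of two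
  absolutely convergent scalar series. Their Cauchy product groups the terms by total degree, and
  the sums over \<open>u\<close> and \<open>v\<close> are finite.\<close>

lemma mat_exp_sandwich_sums:
  fixes A X B :: "complex mat"
  assumes A: "A \<in> carrier_mat n n" and X: "X \<in> carrier_mat n n" and B: "B \<in> carrier_mat n n"
    and ij: "i < n" "j < n"
  shows "(\<lambda>k. \<Sum>p\<le>k. (A ^\<^sub>m p * X * B ^\<^sub>m (k - p)) $$ (i, j) / (fact p * fact (k - p)))
    sums ((mat_exp A * X * mat_exp B) $$ (i, j))"
proof -
  define a where "a u p = (A ^\<^sub>m p) $$ (i, u) / fact p" for u p
  define b where "b v p = (B ^\<^sub>m p) $$ (v, j) / fact p" for v p
  have "(\<lambda>k. \<Sum>p\<le>k. a u p * b v (k - p)) sums (mat_exp A $$ (i, u) * mat_exp B $$ (v, j))"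
    if "u < n" "v < n" for u v
    using Cauchy_product_sums[of "a u" "b v"] summable_norm_mat_exp[OF A ij(1) that(1)]
      summable_norm_mat_exp[OF B that(2) ij(2)]
      sums_unique[OF mat_exp_sums[OF A ij(1) that(1)]] sums_unique[OF mat_exp_sums[OF B that(2) ij(2)]]
    by (simp add: a_def b_def)
  then have "(\<lambda>k. \<Sum>u<n. \<Sum>v<n. X $$ (u, v) * (\<Sum>p\<le>k. a u p * b v (k - p))) sums
    (\<Sum>u<n. \<Sum>v<n. X $$ (u, v) * (mat_exp A $$ (i, u) * mat_exp B $$ (v, j)))"
    by (intro sums_sum sums_mult) auto
  moreover have "(\<Sum>u<n. \<Sum>v<n. X $$ (u, v) * (\<Sum>p\<le>k. a u p * b v (k - p))) =
    (\<Sum>p\<le>k. (A ^\<^sub>m p * X * B ^\<^sub>m (k - p)) $$ (i, j) / (fact p * fact (k - p)))" for k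
  proof -
    have "(A ^\<^sub>m p * X * B ^\<^sub>m (k - p)) $$ (i, j) / (fact p * fact (k - p)) =
      (\<Sum>u<n. \<Sum>v<n. X $$ (u, v) * (a u p * b v (k - p)))" for p
      using A X B ij
      by (subst mult_mat3_index[of _ n n _ n _ n]) (auto simp: a_def b_def sum_divide_distrib intro!: sum.cong)
    then have "(\<Sum>p\<le>k. (A ^\<^sub>m p * X * B ^\<^sub>m (k - p)) $$ (i, j) / (fact p * fact (k - p))) =
      (\<Sum>p\<le>k. \<Sum>u<n. \<Sum>v<n. X $$ (u, v) * (a u p * b v (k - p)))" by simp
    also have "\<dots> = (\<Sum>u<n. \<Sum>v<n. \<Sum>p\<le>k. X $$ (u, v) * (a u p * b v (k - p)))"
      by (subst sum.swap) (simp add: sum.swap[of _ "{..k}"])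
    finally show ?thesis by (simp add: sum_distrib_left)
  qed
  moreover have "(\<Sum>u<n. \<Sum>v<n. X $$ (u, v) * (mat_exp A $$ (i, u) * mat_exp B $$ (v, j))) =
    (mat_exp A * X * mat_exp B) $$ (i, j)"
    using A X B ij by (subst mult_mat3_index[of _ n n _ n _ n]) (auto intro!: sum.cong)
  ultimately show ?thesis by simp
qed

text \<open>Pascal's rule in the form of one induction step of the binomial theorem:
  \<open>f p q\<close> stands for \<open>p\<close> factors on the left and \<open>q\<close> on the
  right.\<close>

lemma sum_binomial_shift:
  fixes f :: "nat \<Rightarrow> nat \<Rightarrow> complex"
  shows "(\<Sum>p\<le>k. of_nat (k choose p) * (f (Suc p) (k - p) + f p (Suc (k - p)))) =
    (\<Sum>p\<le>Suc k. of_nat (Suc k choose p) * f p (Suc k - p))"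
proof -
  have "(\<Sum>p\<le>Suc k. of_nat (Suc k choose p) * f p (Suc k - p)) =
    f 0 (Suc k) + (\<Sum>p\<le>k. of_nat ((k choose Suc p) + (k choose p)) * f (Suc p) (k - p))"
    by (subst sum.atMost_Suc_shift) (simp add: add.commute)
  also have "\<dots> = f 0 (Suc k) + (\<Sum>p\<le>k. of_nat (k choose Suc p) * f (Suc p) (k - p)) +
     (\<Sum>p\<le>k. of_nat (k choose p) * f (Suc p) (k - p))"
    by (simp add: sum.distrib algebra_simps)
  also have "f 0 (Suc k) + (\<Sum>p\<le>k. of_nat (k choose Suc p) * f (Suc p) (k - p)) =
    (\<Sum>p\<le>Suc k. of_nat (k choose p) * f p (Suc k - p))"
    by (subst sum.atMost_Suc_shift) simp
  \<comment> \<open>The top term drops out because \<open>k choose Suc k\<close> is 0.\<close>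
  also have "\<dots> = (\<Sum>p\<le>k. of_nat (k choose p) * f p (Suc (k - p)))"
    by (simp add: Suc_diff_le)
  finally show ?thesis by (simp add: algebra_simps sum.distrib)
qed

lemma pow_mat_Suc_left:
  fixes A :: "complex mat"
  assumes "A \<in> carrier_mat n n"
  shows "A ^\<^sub>m Suc k = A * A ^\<^sub>m k"
proof (induction k)
  case (Suc k)
  then show ?case using assms
    by (simp add: assoc_mult_mat[of A n n "A ^\<^sub>m k" n A n])
qed (use assms in auto)

text \<open>Left multiplication by \<open>A\<close> commutes with right multiplication by
  \<open>B\<close>, so the powers of their sum expand binomially even if \<open>A\<close> and
  \<open>B\<close> do not commute.\<close>

lemma funpow_sum_of_multiplications:
  fixes A X B :: "complex mat"
  assumes A: "A \<in> carrier_mat n n" and B: "B \<in> carrier_mat n n" and X: "X \<in> carrier_mat n n"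
    and \<Phi>: "\<And>Y. Y \<in> carrier_mat n n \<Longrightarrow> \<Phi> Y = A * Y + Y * B"
    and ij: "i < n" "j < n"
  shows "((\<Phi> ^^ k) X) $$ (i, j) =
    (\<Sum>p\<le>k. of_nat (k choose p) * (A ^\<^sub>m p * X * B ^\<^sub>m (k - p)) $$ (i, j))"
  using X
proof (induction k arbitrary: X)
  case 0
  then show ?case using A B by simp
next
  case (Suc k)
  define f where "f p q = (A ^\<^sub>m p * X * B ^\<^sub>m q) $$ (i, j)" for p q
  have *: "(A ^\<^sub>m p * \<Phi> X * B ^\<^sub>m q) $$ (i, j) = f (Suc p) q + f p (Suc q)" for p q
  proof -
    have [simp]: "A ^\<^sub>m p \<in> carrier_mat n n" "B ^\<^sub>m q \<in> carrier_mat n n" using A B by auto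
    have [simp]: "A ^\<^sub>m p * (A * X) \<in> carrier_mat n n" "A ^\<^sub>m p * (X * B) \<in> carrier_mat n n"
      using A B Suc.prems by (auto intro!: mult_carrier_mat[of _ n n])
    have "A ^\<^sub>m p * \<Phi> X * B ^\<^sub>m q = A ^\<^sub>m p * (A * X) * B ^\<^sub>m q + A ^\<^sub>m p * (X * B) * B ^\<^sub>m q"
      using A B Suc.prems by (simp add: \<Phi> mult_add_distrib_mat[of _ n n _ n] add_mult_distrib_mat[of "A ^\<^sub>m p * (A * X)" n n "A ^\<^sub>m p * (X * B)" "B ^\<^sub>m q" n])
    also have "A ^\<^sub>m p * (A * X) * B ^\<^sub>m q = A ^\<^sub>m Suc p * X * B ^\<^sub>m q"
      using A B Suc.prems by (simp add: assoc_mult_mat[of _ n n _ n _ n])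
    also have "A ^\<^sub>m p * (X * B) * B ^\<^sub>m q = A ^\<^sub>m p * X * B ^\<^sub>m Suc q"
      unfolding pow_mat_Suc_left[OF B]
      using A B Suc.prems by (simp add: assoc_mult_mat[of _ n n _ n _ n])
    finally show ?thesis using A B Suc.prems ij by (simp add: f_def del: pow_mat.simps index_mult_mat(1))
  qed
  have "\<Phi> X \<in> carrier_mat n n" using A B Suc.prems by (simp add: \<Phi>)
  then have "((\<Phi> ^^ Suc k) X) $$ (i, j) =
      (\<Sum>p\<le>k. of_nat (k choose p) * (A ^\<^sub>m p * \<Phi> X * B ^\<^sub>m (k - p)) $$ (i, j))"
    by (simp add: funpow_Suc_right Suc.IH del: funpow.simps)
  then show ?case
    by (simp add: * sum_binomial_shift del: sum.atMost_Suc) (simp add: f_def)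
qed

text \<open>Division by \<open>fact k\<close> turns the binomial coefficients into
  \<open>1 / (fact p * fact (k - p))\<close>, the coefficients of the Cauchy product. The result
  serves twice: for the group law of \<open>mat_exp\<close> and for Hamiltonian evolution.\<close>

lemma superop_exp_sum_of_multiplications:
  fixes A X B :: "complex mat"
  assumes A: "A \<in> carrier_mat n n" and B: "B \<in> carrier_mat n n" and X: "X \<in> carrier_mat n n"
    and \<Phi>: "\<And>Y. Y \<in> carrier_mat n n \<Longrightarrow> \<Phi> Y = A * Y + Y * B"
  shows "superop_exp n \<Phi> X = mat_exp A * X * mat_exp B"
proof (rule eq_matI)
  fix i j assume "i < dim_row (mat_exp A * X * mat_exp B)" "j < dim_col (mat_exp A * X * mat_exp B)"
  then have ij: "i < n" "j < n" using mat_exp_carrier[OF A] mat_exp_carrier[OF B] by auto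
  have "((\<Phi> ^^ k) X) $$ (i, j) / fact k =
    (\<Sum>p\<le>k. (A ^\<^sub>m p * X * B ^\<^sub>m (k - p)) $$ (i, j) / (fact p * fact (k - p)))" for k
    using funpow_sum_of_multiplications[of A n B X \<Phi> i j k] A B X \<Phi> ij
    by (simp add: sum_divide_distrib binomial_fact del: index_mult_mat)
  then show "superop_exp n \<Phi> X $$ (i, j) = (mat_exp A * X * mat_exp B) $$ (i, j)"
    using sums_unique[OF mat_exp_sandwich_sums[OF A X B ij]] ij by (simp add: superop_exp_def)
qed (use mat_exp_carrier[OF A] mat_exp_carrier[OF B] in \<open>auto simp: superop_exp_def\<close>)

section \<open>One-parameter unitary groups\<close>

lemma pow_mat_smult:
  fixes C :: "complex mat"
  assumes C: "C \<in> carrier_mat n n"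
  shows "(r \<cdot>\<^sub>m C) ^\<^sub>m k = r ^ k \<cdot>\<^sub>m C ^\<^sub>m k"
proof (induction k)
  case 0
  then show ?case using C by auto
next
  case (Suc k)
  have Ck: "C ^\<^sub>m k \<in> carrier_mat n n" using C by simp
  have "(r \<cdot>\<^sub>m C) ^\<^sub>m Suc k = r ^ k \<cdot>\<^sub>m (C ^\<^sub>m k * (r \<cdot>\<^sub>m C))"
    using mult_smult_assoc_mat[of "C ^\<^sub>m k" n n "r \<cdot>\<^sub>m C" n "r ^ k"] C by (simp add: Suc)
  also have "C ^\<^sub>m k * (r \<cdot>\<^sub>m C) = r \<cdot>\<^sub>m C ^\<^sub>m Suc k"
    using mult_smult_distrib[OF Ck C] by simp
  also have "r ^ k \<cdot>\<^sub>m (r \<cdot>\<^sub>m C ^\<^sub>m Suc k) = r ^ Suc k \<cdot>\<^sub>m C ^\<^sub>m Suc k"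
    using C by (intro eq_matI) (auto simp: mult_ac simp del: index_mult_mat)
  finally show ?case .
qed

lemma mat_exp_zero_smult:
  fixes C :: "complex mat"
  assumes C: "C \<in> carrier_mat n n"
  shows "mat_exp (0 \<cdot>\<^sub>m C) = 1\<^sub>m n"
proof (rule eq_matI)
  fix i j assume "i < dim_row (1\<^sub>m n)" "j < dim_col (1\<^sub>m n)"
  then have ij: "i < n" "j < n" by auto
  have "(\<lambda>k. ((C ^\<^sub>m k) $$ (i, j) / fact k) * 0 ^ k) sums ((C ^\<^sub>m 0) $$ (i, j) / fact 0)"
    by (rule powser_sums_zero)
  moreover have "((0 \<cdot>\<^sub>m C) ^\<^sub>m k) $$ (i, j) / fact k = ((C ^\<^sub>m k) $$ (i, j) / fact k) * 0 ^ k" for k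
    using C ij by (simp add: pow_mat_smult[OF C])
  ultimately show "mat_exp (0 \<cdot>\<^sub>m C) $$ (i, j) = 1\<^sub>m n $$ (i, j)"
    using sums_unique2[OF mat_exp_sums[of "0 \<cdot>\<^sub>m C" n i j]] C ij by simp
qed (use C in \<open>auto simp: mat_exp_def\<close>)

text \<open>On polynomials in \<open>C\<close> left and right multiplication by \<open>C\<close>
  agree, so iterating \<open>\<Phi>\<close> from the identity produces the powers of
  \<open>(s + t) \<cdot>\<^sub>m C\<close>. The exponential of \<open>\<Phi>\<close> at the identity
  is thus computed in two ways.\<close>

lemma mat_exp_add_smult:
  fixes C :: "complex mat"
  assumes C: "C \<in> carrier_mat n n"
  shows "mat_exp (s \<cdot>\<^sub>m C) * mat_exp (t \<cdot>\<^sub>m C) = mat_exp ((s + t) \<cdot>\<^sub>m C)"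
proof -
  define \<Phi> where "\<Phi> = (\<lambda>X. (s \<cdot>\<^sub>m C) * X + X * (t \<cdot>\<^sub>m C))"
  have pow: "(\<Phi> ^^ k) (1\<^sub>m n) = ((s + t) \<cdot>\<^sub>m C) ^\<^sub>m k" for k
  proof (induction k)
    case 0
    then show ?case using C by simp
  next
    case (Suc k)
    define P where "P = ((s + t) \<cdot>\<^sub>m C) ^\<^sub>m k"
    have P: "P \<in> carrier_mat n n" using C by (simp add: P_def)
    have comm: "C * P = P * C"
      using C pow_mat_Suc_left[OF C, of k] mult_smult_distrib[OF C, of "C ^\<^sub>m k" n]
        mult_smult_assoc_mat[of "C ^\<^sub>m k" n n C n]
      by (simp add: P_def pow_mat_smult[OF C])
    have "\<Phi> P = s \<cdot>\<^sub>m (P * C) + t \<cdot>\<^sub>m (P * C)"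
      using mult_smult_assoc_mat[OF C P] mult_smult_distrib[OF P C] by (simp add: \<Phi>_def comm)
    also have "\<dots> = (s + t) \<cdot>\<^sub>m (P * C)"
      by (metis add_smult_distrib_right_mat carrier_mat_triv)
    also have "\<dots> = P * ((s + t) \<cdot>\<^sub>m C)" using mult_smult_distrib[OF P C] by simp
    finally show ?case using Suc by (simp add: P_def)
  qed
  have "superop_exp n \<Phi> (1\<^sub>m n) = mat_exp (s \<cdot>\<^sub>m C) * 1\<^sub>m n * mat_exp (t \<cdot>\<^sub>m C)"
    using C by (intro superop_exp_sum_of_multiplications) (auto simp: \<Phi>_def)
  moreover have "superop_exp n \<Phi> (1\<^sub>m n) = mat_exp ((s + t) \<cdot>\<^sub>m C)"
    using C by (auto simp: superop_exp_def mat_exp_def pow)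
  ultimately show ?thesis using right_mult_one_mat[OF mat_exp_carrier[of "s \<cdot>\<^sub>m C" n]] C by simp
qed

lemma mat_adjoint_mult:
  fixes A B :: "complex mat"
  assumes A: "A \<in> carrier_mat n m" and B: "B \<in> carrier_mat m k"
  shows "mat_adjoint (A * B) = mat_adjoint B * mat_adjoint A"
proof (rule eq_matI)
  fix i j assume "i < dim_row (mat_adjoint B * mat_adjoint A)" "j < dim_col (mat_adjoint B * mat_adjoint A)"
  then have ij: "i < k" "j < n"
    using mat_adjoint_carrier[OF A] mat_adjoint_carrier[OF B] by auto
  have "mat_adjoint (A * B) $$ (i, j) = cnj ((A * B) $$ (j, i))"
    using A B ij by (intro mat_adjoint_index) auto
  also have "\<dots> = (\<Sum>l<m. mat_adjoint B $$ (i, l) * mat_adjoint A $$ (l, j))"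
    using A B ij by (simp add: mult_mat_index[OF A B] mult.commute del: index_mult_mat)
  also have "\<dots> = (mat_adjoint B * mat_adjoint A) $$ (i, j)"
    using A B ij by (simp add: mult_mat_index[of _ k m _ n] del: index_mult_mat)
  finally show "mat_adjoint (A * B) $$ (i, j) = (mat_adjoint B * mat_adjoint A) $$ (i, j)" .
qed (use mat_adjoint_carrier[OF A] mat_adjoint_carrier[OF B] mat_adjoint_carrier[OF mult_carrier_mat[OF A B]] in auto)

lemma mat_adjoint_one: "mat_adjoint (1\<^sub>m n :: complex mat) = 1\<^sub>m n"
  by (rule eq_matI) (auto simp: mat_adjoint_def mat_of_rows_index)

lemma mat_adjoint_pow:
  fixes A :: "complex mat"
  assumes A: "A \<in> carrier_mat n n"
  shows "mat_adjoint (A ^\<^sub>m k) = mat_adjoint A ^\<^sub>m k"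
proof (induction k)
  case 0
  then show ?case using A carrier_matD[OF mat_adjoint_carrier[OF A]] by (simp add: mat_adjoint_one)
next
  case (Suc k)
  have "mat_adjoint (A ^\<^sub>m Suc k) = mat_adjoint A * mat_adjoint (A ^\<^sub>m k)"
    using mat_adjoint_mult[OF pow_carrier_mat[OF A] A] by simp
  then show ?case using pow_mat_Suc_left[OF mat_adjoint_carrier[OF A]] by (simp add: Suc)
qed

lemma mat_adjoint_mat_exp:
  fixes A :: "complex mat"
  assumes A: "A \<in> carrier_mat n n"
  shows "mat_adjoint (mat_exp A) = mat_exp (mat_adjoint A)"
proof (rule eq_matI)
  note A' = mat_adjoint_carrier[OF A]
  fix i j assume "i < dim_row (mat_exp (mat_adjoint A))" "j < dim_col (mat_exp (mat_adjoint A))"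
  then have ij: "i < n" "j < n" using mat_exp_carrier[OF A'] by auto
  have "(\<lambda>k. cnj ((A ^\<^sub>m k) $$ (j, i) / fact k)) sums cnj (mat_exp A $$ (j, i))"
    unfolding sums_cnj using mat_exp_sums[OF A ij(2,1)] .
  moreover have "cnj ((A ^\<^sub>m k) $$ (j, i) / fact k) = (mat_adjoint A ^\<^sub>m k) $$ (i, j) / fact k" for k
    using A ij mat_adjoint_index[of i "A ^\<^sub>m k" j] by (simp add: mat_adjoint_pow)
  ultimately have "cnj (mat_exp A $$ (j, i)) = mat_exp (mat_adjoint A) $$ (i, j)"
    using sums_unique2 mat_exp_sums[OF A' ij] by simp
  then show "mat_adjoint (mat_exp A) $$ (i, j) = mat_exp (mat_adjoint A) $$ (i, j)"
    using mat_exp_carrier[OF A] ij by simp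
qed (use carrier_matD[OF mat_exp_carrier[OF mat_adjoint_carrier[OF A]]] carrier_matD[OF mat_adjoint_carrier[OF mat_exp_carrier[OF A]]] in simp_all)

lemma mat_adjoint_smult:
  fixes A :: "complex mat"
  assumes A: "A \<in> carrier_mat n m"
  shows "mat_adjoint (c \<cdot>\<^sub>m A) = cnj c \<cdot>\<^sub>m mat_adjoint A"
  using A by (intro eq_matI) (auto simp: mat_adjoint_def mat_of_rows_index)

lemma mat_exp_unitary_group:
  assumes H: "hermitian_mat n H"
  shows "mat_adjoint (mat_exp ((- \<i> * complex_of_real t) \<cdot>\<^sub>m H)) = mat_exp ((\<i> * complex_of_real t) \<cdot>\<^sub>m H)"
    and "unitary_mat n (mat_exp ((- \<i> * complex_of_real t) \<cdot>\<^sub>m H))"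
proof -
  have C: "H \<in> carrier_mat n n" "mat_adjoint H = H" using H by (auto simp: hermitian_mat_def)
  show adj: "mat_adjoint (mat_exp ((- \<i> * complex_of_real t) \<cdot>\<^sub>m H)) = mat_exp ((\<i> * complex_of_real t) \<cdot>\<^sub>m H)"
    using C mat_adjoint_mat_exp[of "(- \<i> * complex_of_real t) \<cdot>\<^sub>m H" n] mat_adjoint_smult[OF C(1)] by simp
  show "unitary_mat n (mat_exp ((- \<i> * complex_of_real t) \<cdot>\<^sub>m H))"
    unfolding unitary_mat_def adj using C
    by (simp add: mat_exp_add_smult mat_exp_zero_smult)
qed

section \<open>Recurrence of unitary groups\<close>

lemma unitary_mat_entry_le_1:
  assumes U: "unitary_mat n U" and ij: "i < n" "j < n"
  shows "cmod (U $$ (i, j)) \<le> 1"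
proof -
  have C: "U \<in> carrier_mat n n" using U by (simp add: unitary_mat_def)
  have "complex_of_real (\<Sum>l<n. (cmod (U $$ (i, l)))\<^sup>2) = (U * mat_adjoint U) $$ (i, i)"
    using C ij mult_mat_index[OF C mat_adjoint_carrier[OF C] ij(1) ij(1)]
    by (simp only: of_real_sum complex_norm_square) (simp del: index_mult_mat)
  also have "\<dots> = complex_of_real 1" using U ij by (simp add: unitary_mat_def)
  finally have *: "(\<Sum>l<n. (cmod (U $$ (i, l)))\<^sup>2) = 1" using of_real_eq_iff by blast
  have "(cmod (U $$ (i, j)))\<^sup>2 \<le> (\<Sum>l<n. (cmod (U $$ (i, l)))\<^sup>2)"
    using ij by (intro member_le_sum[of j "{..<n}" "\<lambda>l. (cmod (U $$ (i, l)))\<^sup>2"]) auto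
  then show ?thesis using * by (simp add: power2_le_iff_abs_le abs_square_le_1)
qed

text \<open>Rounding the real and imaginary parts of all entries to a grid of mesh \<open>e\<close>
  leaves finitely many codes, so two indices share one. Each part then differs by at most
  \<open>e\<close>, which gives \<open>2 * e\<close> for the modulus.\<close>

lemma bounded_entries_close_pair:
  fixes V :: "nat \<Rightarrow> complex mat"
  assumes bound: "\<And>m i j. i < N \<Longrightarrow> j < N \<Longrightarrow> cmod (V m $$ (i, j)) \<le> 1" and e: "e > 0"
  shows "\<exists>m m'. m < m' \<and> (\<forall>i<N. \<forall>j<N. cmod (V m' $$ (i, j) - V m $$ (i, j)) \<le> 2 * e)"
proof -
  \<comment> \<open>Numbers in \<open>[-1, 1]\<close> have grid index between \<open>-K\<close> and
    \<open>K\<close>; the added 1 is a margin for the rounding.\<close>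
  define K where "K = \<lceil>1 / e\<rceil> + 1"
  define code where "code m = (\<lambda>ij\<in>{..<N} \<times> {..<N}. (\<lfloor>Re (V m $$ ij) / e\<rfloor>, \<lfloor>Im (V m $$ ij) / e\<rfloor>))" for m
  have fl: "\<lfloor>x / e\<rfloor> \<in> {-K..K}" if "\<bar>x\<bar> \<le> 1" for x :: real
  proof -
    have "x / e \<le> 1 / e" "-(1 / e) \<le> x / e" using that e by (auto simp: field_simps abs_le_iff)
    then show ?thesis unfolding K_def by (auto simp: le_floor_iff floor_le_iff) linarith+
  qed
  have "code m \<in> ({..<N} \<times> {..<N}) \<rightarrow>\<^sub>E ({-K..K} \<times> {-K..K})" for m
    unfolding code_def using bound order_trans[OF abs_Re_le_cmod] order_trans[OF abs_Im_le_cmod]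
    by (intro restrict_PiE_iff[THEN iffD2] ballI) (auto simp del: atLeastAtMost_iff intro!: fl)
  then have "finite (range code)"
    by (intro finite_subset[OF _ finite_PiE[of "{..<N} \<times> {..<N}" "\<lambda>_. {-K..K} \<times> {-K..K}"]]) auto
  then have "\<not> inj code" using finite_imageD[of code UNIV] by auto
  then obtain m m' where "m \<noteq> m'" "code m = code m'" by (auto simp: inj_on_def)
  then obtain m m' where mm: "m < m'" "code m = code m'" by (metis linorder_neqE_nat)
  have close: "\<bar>x - y\<bar> \<le> e" if "\<lfloor>x / e\<rfloor> = \<lfloor>y / e\<rfloor>" for x y :: real
  proof -
    have "\<bar>x / e - y / e\<bar> \<le> 1" using that by linarith
    then show ?thesis using e by (simp add: diff_divide_distrib[symmetric] abs_le_iff field_simps)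
  qed
  have "cmod (V m' $$ (i, j) - V m $$ (i, j)) \<le> 2 * e" if "i < N" "j < N" for i j
  proof -
    have "code m (i, j) = code m' (i, j)" using mm by simp
    then have "\<bar>Re (V m' $$ (i, j)) - Re (V m $$ (i, j))\<bar> \<le> e" "\<bar>Im (V m' $$ (i, j)) - Im (V m $$ (i, j))\<bar> \<le> e"
      using that close by (auto simp: code_def)
    then show ?thesis using cmod_le[of "V m' $$ (i, j) - V m $$ (i, j)"] by simp
  qed
  then show ?thesis using mm by blast
qed

text \<open>If \<open>U m\<close> and \<open>U m'\<close> are close, then multiplying by
  \<open>U (- m)\<close>, whose entries are bounded by 1, shows that \<open>U (m' - m)\<close> is
  close to the identity. In the limit clause \<open>k\<close> is bound anew by the sequence, so this
  clause does not depend on the outer \<open>k\<close>.\<close>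

lemma mat_exp_recurrent:
  assumes H: "hermitian_mat N H"
  shows "\<exists>q :: nat \<Rightarrow> nat. \<forall>k. q k \<ge> 1 \<and>
    (\<forall>i<N. \<forall>j<N. (\<lambda>k. mat_exp ((- \<i> * complex_of_real (real (q k))) \<cdot>\<^sub>m H) $$ (i, j)) \<longlonglongrightarrow> 1\<^sub>m N $$ (i, j))"
proof -
  define U where "U t = mat_exp ((- \<i> * complex_of_real t) \<cdot>\<^sub>m H)" for t
  have C: "H \<in> carrier_mat N N" using H by (simp add: hermitian_mat_def)
  have U: "U t \<in> carrier_mat N N" for t using C by (simp add: U_def)
  have bound: "cmod (U t $$ (i, j)) \<le> 1" if "i < N" "j < N" for t i j
    using unitary_mat_entry_le_1[OF mat_exp_unitary_group(2)[OF H]] that by (simp add: U_def)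
  have add: "U s * U t = U (s + t)" for s t
    by (simp add: U_def mat_exp_add_smult[OF C] ring_distribs)
  have one: "U 0 = 1\<^sub>m N" by (simp add: U_def mat_exp_zero_smult[OF C])
  have "\<exists>q\<ge>1. \<forall>i<N. \<forall>j<N. cmod (U (real q) $$ (i, j) - 1\<^sub>m N $$ (i, j)) \<le> e" if e: "e > 0" for e
  proof -
    \<comment> \<open>Each entry of the product is a sum of \<open>N\<close> terms of modulus at
      most \<open>2 * e'\<close>, hence at most \<open>e\<close>; the added 1 keeps the denominator
      positive when \<open>N = 0\<close>.\<close>
    define e' where "e' = e / (2 * (real N + 1))"
    have e': "e' > 0" using e by (simp add: e'_def)
    obtain m m' :: nat where m: "m < m'"
      and close: "\<And>i j. i < N \<Longrightarrow> j < N \<Longrightarrow> cmod (U (real m') $$ (i, j) - U (real m) $$ (i, j)) \<le> 2 * e'"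
      using bounded_entries_close_pair[of N "\<lambda>m. U (real m)" e', OF bound e'] by blast
    have "cmod (U (real (m' - m)) $$ (i, j) - 1\<^sub>m N $$ (i, j)) \<le> e" if ij: "i < N" "j < N" for i j
    proof -
      have "U (real (m' - m)) = U (- real m) * U (real m')" using m by (simp add: add of_nat_diff)
      moreover have "1\<^sub>m N = U (- real m) * U (real m)" by (simp add: add one)
      ultimately have "U (real (m' - m)) $$ (i, j) - 1\<^sub>m N $$ (i, j) =
          (\<Sum>l<N. U (- real m) $$ (i, l) * (U (real m') $$ (l, j) - U (real m) $$ (l, j)))"
        using mult_mat_index[OF U U ij] by (simp add: sum_subtractf algebra_simps del: index_mult_mat index_one_mat)
      also have "cmod \<dots> \<le> (\<Sum>l<N. 1 * (2 * e'))"
        using bound close ij unfolding norm_mult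
          by (intro order_trans[OF norm_sum] sum_mono) (simp only: norm_mult lessThan_iff, intro mult_mono, auto)
      also have "\<dots> \<le> e" using e by (simp add: e'_def field_simps)
      finally show ?thesis .
    qed
    then show ?thesis using m by (intro exI[of _ "m' - m"]) auto
  qed
  then have "\<forall>k. \<exists>q\<ge>1. \<forall>i<N. \<forall>j<N. cmod (U (real q) $$ (i, j) - 1\<^sub>m N $$ (i, j)) \<le> inverse (real (Suc k))"
    by simp
  then obtain q :: "nat \<Rightarrow> nat" where q: "\<And>k. q k \<ge> 1"
    "\<And>k i j. i < N \<Longrightarrow> j < N \<Longrightarrow> cmod (U (real (q k)) $$ (i, j) - 1\<^sub>m N $$ (i, j)) \<le> inverse (real (Suc k))"
    by metis
  have "(\<lambda>k. U (real (q k)) $$ (i, j)) \<longlonglongrightarrow> 1\<^sub>m N $$ (i, j)" if "i < N" "j < N" for i j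
    by (rule LIM_zero_cancel, rule tendsto_norm_zero_cancel,
        rule real_tendsto_sandwich[OF _ _ tendsto_const LIMSEQ_inverse_real_of_nat])
       (use q(2)[OF that] in auto)
  then show ?thesis using q(1) unfolding U_def by blast
qed

section \<open>Linear maps on matrices as matrices\<close>

text \<open>The matrix of \<open>\<Phi>\<close> with respect to the matrix units, where the pair
  \<open>(a, b)\<close> is flattened to \<open>a * n + b\<close>. Having such a matrix is how
  linearity is expressed for a map that is specified only on \<open>carrier_mat n n\<close>.\<close>

definition superop_matrix :: "nat \<Rightarrow> complex mat \<Rightarrow> (complex mat \<Rightarrow> complex mat) \<Rightarrow> bool" where
  "superop_matrix n M \<Phi> \<longleftrightarrow> M \<in> carrier_mat (n * n) (n * n) \<and>
     (\<forall>X\<in>carrier_mat n n. \<Phi> X \<in> carrier_mat n n \<and>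
       (\<forall>a<n. \<forall>b<n. \<Phi> X $$ (a, b) = (\<Sum>c<n. \<Sum>d<n. M $$ (a * n + b, c * n + d) * X $$ (c, d))))"

lemma superop_matrix_smult:
  assumes "superop_matrix n M \<Phi>"
  shows "superop_matrix n (s \<cdot>\<^sub>m M) (\<lambda>X. s \<cdot>\<^sub>m \<Phi> X)"
  using assms by (auto simp: superop_matrix_def sum_distrib_left product_index_less mult.assoc)

lemma superop_matrix_homogeneous:
  assumes M: "superop_matrix n M \<Phi>" and X: "X \<in> carrier_mat n n"
  shows "\<Phi> (c \<cdot>\<^sub>m X) = c \<cdot>\<^sub>m \<Phi> X"
proof (rule eq_matI)
  have C: "\<Phi> (c \<cdot>\<^sub>m X) \<in> carrier_mat n n" "\<Phi> X \<in> carrier_mat n n"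
    using M X by (auto simp: superop_matrix_def)
  then show "dim_row (\<Phi> (c \<cdot>\<^sub>m X)) = dim_row (c \<cdot>\<^sub>m \<Phi> X)" "dim_col (\<Phi> (c \<cdot>\<^sub>m X)) = dim_col (c \<cdot>\<^sub>m \<Phi> X)"
    by auto
  fix a b assume "a < dim_row (c \<cdot>\<^sub>m \<Phi> X)" "b < dim_col (c \<cdot>\<^sub>m \<Phi> X)"
  then have ab: "a < n" "b < n" using C by auto
  have *: "\<Phi> Y $$ (a, b) = (\<Sum>c<n. \<Sum>d<n. M $$ (a * n + b, c * n + d) * Y $$ (c, d))"
    if "Y \<in> carrier_mat n n" for Y
    using M that ab by (simp add: superop_matrix_def)
  show "\<Phi> (c \<cdot>\<^sub>m X) $$ (a, b) = (c \<cdot>\<^sub>m \<Phi> X) $$ (a, b)"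
    using X C ab *[of X] *[of "c \<cdot>\<^sub>m X"] by (simp add: sum_distrib_left mult_ac)
qed

lemma superop_matrix_pow:
  assumes M: "superop_matrix n M \<Phi>"
  shows "superop_matrix n (M ^\<^sub>m k) (\<Phi> ^^ k)"
proof (induction k)
  case 0
  have C: "M \<in> carrier_mat (n * n) (n * n)" using M by (simp add: superop_matrix_def)
  have "X $$ (a, b) = (\<Sum>c<n. \<Sum>d<n. (M ^\<^sub>m 0) $$ (a * n + b, c * n + d) * X $$ (c, d))"
    if ab: "a < n" "b < n" for X a b
  proof -
    have "(\<Sum>c<n. \<Sum>d<n. (M ^\<^sub>m 0) $$ (a * n + b, c * n + d) * X $$ (c, d)) =
      (\<Sum>q<n * n. (if q = a * n + b then X $$ (q div n, q mod n) else 0))"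
      unfolding sum_product_index using C ab
      by (intro sum.cong refl) (auto simp: product_index_less product_index_eq_iff)
    also have "\<dots> = X $$ (a, b)"
      using sum_delta_mult(1)[OF product_index_less[OF ab], of "\<lambda>q. X $$ (q div n, q mod n)"] ab by simp
    finally show ?thesis by simp
  qed
  then show ?case using C unfolding superop_matrix_def by (simp only: funpow.simps id_apply pow_carrier_mat) blast
next
  case (Suc k)
  have C: "M \<in> carrier_mat (n * n) (n * n)" using M by (simp add: superop_matrix_def)
  have "(\<Phi> ^^ Suc k) X $$ (a, b) = (\<Sum>e<n. \<Sum>f<n. (M ^\<^sub>m Suc k) $$ (a * n + b, e * n + f) * X $$ (e, f))"
    if X: "X \<in> carrier_mat n n" and ab: "a < n" "b < n" for X a b
  proof -
    have Y: "(\<Phi> ^^ k) X \<in> carrier_mat n n"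
      and Y_index: "\<And>c d. c < n \<Longrightarrow> d < n \<Longrightarrow> (\<Phi> ^^ k) X $$ (c, d) =
        (\<Sum>e<n. \<Sum>f<n. (M ^\<^sub>m k) $$ (c * n + d, e * n + f) * X $$ (e, f))"
      using Suc X unfolding superop_matrix_def by blast+
    have "\<Phi> Z $$ (a, b) = (\<Sum>c<n. \<Sum>d<n. M $$ (a * n + b, c * n + d) * Z $$ (c, d))"
      if "Z \<in> carrier_mat n n" for Z
      using M ab that unfolding superop_matrix_def by blast
    from this[OF Y] have "(\<Phi> ^^ Suc k) X $$ (a, b) = (\<Sum>c<n. \<Sum>d<n. M $$ (a * n + b, c * n + d) * (\<Phi> ^^ k) X $$ (c, d))"
      by simp
    also have "\<dots> = (\<Sum>c<n. \<Sum>d<n. \<Sum>e<n. \<Sum>f<n. M $$ (a * n + b, c * n + d) * (M ^\<^sub>m k) $$ (c * n + d, e * n + f) * X $$ (e, f))"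
      by (intro sum.cong refl) (simp add: Y_index sum_distrib_left mult.assoc)
    \<comment> \<open>Flattening both index pairs exposes a matrix product; \<open>div\<close> and
      \<open>mod\<close> recover the pair that indexes \<open>X\<close>.\<close>
    also have "\<dots> = (\<Sum>p<n * n. \<Sum>q<n * n. M $$ (a * n + b, p) * (M ^\<^sub>m k) $$ (p, q) * X $$ (q div n, q mod n))"
      by (simp add: sum_product_index)
    also have "\<dots> = (\<Sum>q<n * n. (\<Sum>p<n * n. M $$ (a * n + b, p) * (M ^\<^sub>m k) $$ (p, q)) * X $$ (q div n, q mod n))"
      by (subst sum.swap) (simp add: sum_distrib_right)
    also have "\<dots> = (\<Sum>q<n * n. (M ^\<^sub>m Suc k) $$ (a * n + b, q) * X $$ (q div n, q mod n))"
      unfolding pow_mat_Suc_left[OF C] using C ab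
      by (intro sum.cong refl) (simp add: mult_mat_index[of M "n * n" "n * n" _ "n * n"] product_index_less del: index_mult_mat)
    also have "\<dots> = (\<Sum>e<n. \<Sum>f<n. (M ^\<^sub>m Suc k) $$ (a * n + b, e * n + f) * X $$ (e, f))"
      by (simp add: sum_product_index)
    finally show ?thesis .
  qed
  moreover have "(\<Phi> ^^ Suc k) X \<in> carrier_mat n n" if "X \<in> carrier_mat n n" for X
    using M Suc that by (simp add: superop_matrix_def)
  ultimately show ?case using C unfolding superop_matrix_def by (blast intro: pow_carrier_mat)
qed

text \<open>The iterates of \<open>t L\<close> have the powers of \<open>t M\<close> as matrices, so
  convergence of the superoperator series is inherited from \<open>mat_exp\<close>.\<close>

lemma quantum_process_entry:
  assumes M: "superop_matrix n M L" and X: "X \<in> carrier_mat n n" and ab: "a < n" "b < n"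
  shows "quantum_process n L t X $$ (a, b) =
    (\<Sum>c<n. \<Sum>d<n. mat_exp (complex_of_real t \<cdot>\<^sub>m M) $$ (a * n + b, c * n + d) * X $$ (c, d))"
proof -
  define N where "N = complex_of_real t \<cdot>\<^sub>m M"
  have C: "N \<in> carrier_mat (n * n) (n * n)" using M by (simp add: superop_matrix_def N_def)
  have "((\<lambda>X. complex_of_real t \<cdot>\<^sub>m L X) ^^ k) X $$ (a, b) / fact k =
      (\<Sum>c<n. \<Sum>d<n. (N ^\<^sub>m k) $$ (a * n + b, c * n + d) / fact k * X $$ (c, d))" for k
    using superop_matrix_pow[OF superop_matrix_smult[OF M, of "complex_of_real t"], of k] X ab
    by (simp add: superop_matrix_def N_def sum_divide_distrib)
  moreover have "(\<lambda>k. \<Sum>c<n. \<Sum>d<n. (N ^\<^sub>m k) $$ (a * n + b, c * n + d) / fact k * X $$ (c, d)) sums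
      (\<Sum>c<n. \<Sum>d<n. mat_exp N $$ (a * n + b, c * n + d) * X $$ (c, d))"
    using C ab by (intro sums_sum sums_mult2 mat_exp_sums) (auto intro: product_index_less)
  ultimately show ?thesis
    using ab by (simp add: quantum_process_def superop_exp_def sums_iff N_def)
qed

lemma quantum_process_eigenvector:
  assumes M: "superop_matrix n M L" and X: "X \<in> carrier_mat n n" and LX: "L X = z \<cdot>\<^sub>m X"
  shows "quantum_process n L t X = exp (complex_of_real t * z) \<cdot>\<^sub>m X"
proof -
  have pow: "((\<lambda>X. complex_of_real t \<cdot>\<^sub>m L X) ^^ k) X = (complex_of_real t * z) ^ k \<cdot>\<^sub>m X" for k
  proof (induction k)
    case (Suc k)
    have "((\<lambda>X. complex_of_real t \<cdot>\<^sub>m L X) ^^ Suc k) X = complex_of_real t \<cdot>\<^sub>m L ((complex_of_real t * z) ^ k \<cdot>\<^sub>m X)"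
      by (simp add: Suc)
    also have "\<dots> = complex_of_real t \<cdot>\<^sub>m ((complex_of_real t * z) ^ k \<cdot>\<^sub>m (z \<cdot>\<^sub>m X))"
      by (simp add: superop_matrix_homogeneous[OF M X] LX)
    also have "\<dots> = (complex_of_real t * z) ^ Suc k \<cdot>\<^sub>m X" by (intro eq_matI) (auto simp: mult_ac)
    finally show ?case .
  qed (intro eq_matI, auto)
  have "(\<lambda>k. (complex_of_real t * z) ^ k / fact k) sums exp (complex_of_real t * z)"
    using exp_converges[of "complex_of_real t * z"] by (simp add: scaleR_conv_of_real field_simps)
  then have "(\<lambda>k. (complex_of_real t * z) ^ k / fact k * w) sums (exp (complex_of_real t * z) * w)" for w
    by (rule sums_mult2)
  then have "(\<Sum>k. (complex_of_real t * z) ^ k * w / fact k) = exp (complex_of_real t * z) * w" for w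
    by (simp add: sums_iff)
  then show ?thesis
    using X by (intro eq_matI) (auto simp: quantum_process_def superop_exp_def pow)
qed

section \<open>Eigenvalues detected by the trace\<close>

lemma mat_trace_mult_comm:
  assumes A: "A \<in> carrier_mat n m" and B: "B \<in> carrier_mat m n"
  shows "mat_trace (A * B) = mat_trace (B * A)"
proof -
  have "mat_trace (A * B) = (\<Sum>i<n. \<Sum>j<m. A $$ (i, j) * B $$ (j, i))"
    using A B by (simp add: mat_trace_def mult_mat_index[OF A B] del: index_mult_mat(1))
  also have "\<dots> = (\<Sum>j<m. \<Sum>i<n. B $$ (j, i) * A $$ (i, j))"
    by (subst sum.swap) (simp add: mult.commute)
  also have "\<dots> = mat_trace (B * A)"
    using A B by (simp add: mat_trace_def mult_mat_index[OF B A] del: index_mult_mat(1))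
  finally show ?thesis .
qed

text \<open>Schur triangularisation preserves the trace and puts roots of the characteristic
  polynomial on the diagonal. If their sum has negative real part, so has one of them.\<close>

lemma eigenvalue_with_negative_real_part:
  assumes A: "A \<in> carrier_mat N N" and tr: "Re (mat_trace A) < 0"
  shows "\<exists>z. eigenvalue A z \<and> Re z < 0"
proof -
  obtain es where es: "char_poly A = (\<Prod>a\<leftarrow>es. [:- a, 1:])" using char_poly_factorized[OF A] by blast
  obtain T where T: "T \<in> carrier_mat N N" "upper_triangular T" and sim: "similar_mat A T"
    using schur_decomposition_exists[OF A es] by blast
  obtain P Q where PQ: "P \<in> carrier_mat N N" "Q \<in> carrier_mat N N" "Q * P = 1\<^sub>m N" "A = P * T * Q"
    using sim A by (auto simp: similar_mat_def similar_mat_wit_def Let_def)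
  have "mat_trace A = mat_trace (Q * (P * T))"
    unfolding PQ(4) using PQ T by (intro mat_trace_mult_comm[of _ N N]) auto
  also have "Q * (P * T) = T"
    using PQ T by (simp add: assoc_mult_mat[of Q N N P N T N, symmetric])
  finally have "Re (mat_trace T) < 0" using tr by simp
  then have "(\<Sum>i<N. Re (T $$ (i, i))) < 0" using T by (simp add: mat_trace_def)
  then obtain i where i: "i < N" "Re (T $$ (i, i)) < 0"
    using sum_nonneg[of "{..<N}" "\<lambda>i. Re (T $$ (i, i))"] by force
  have "T $$ (i, i) \<in> set (diag_mat T)" using i T by (auto simp: diag_mat_def)
  then have "poly (char_poly A) (T $$ (i, i)) = 0"
    unfolding char_poly_similar[OF sim] char_poly_upper_triangular[OF T]
    by (force simp: poly_prod_list prod_list_zero_iff)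
  then show ?thesis using i eigenvalue_root_char_poly[OF A] by blast
qed

lemma superop_eigenvector_with_negative_real_part:
  assumes M: "superop_matrix n M \<Phi>" and tr: "Re (mat_trace M) < 0"
  obtains z X where "X \<in> carrier_mat n n" "X \<noteq> 0\<^sub>m n n" "\<Phi> X = z \<cdot>\<^sub>m X" "Re z < 0"
proof -
  have C: "M \<in> carrier_mat (n * n) (n * n)" using M by (simp add: superop_matrix_def)
  obtain z v where z: "Re z < 0" and v: "v \<in> carrier_vec (n * n)" "v \<noteq> 0\<^sub>v (n * n)" "M *\<^sub>v v = z \<cdot>\<^sub>v v"
    using eigenvalue_with_negative_real_part[OF C tr] C unfolding eigenvalue_def eigenvector_def by auto
  define X where "X = mat n n (\<lambda>(a, b). v $ (a * n + b))"
  have X: "X \<in> carrier_mat n n" by (simp add: X_def)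
  have "X \<noteq> 0\<^sub>m n n"
  proof
    assume "X = 0\<^sub>m n n"
    have "v $ p = 0" if p: "p < n * n" for p
    proof -
      have "n > 0" using p by (cases n) auto
      then have "p div n < n" "p mod n < n" using p by (auto simp: less_mult_imp_div_less)
      then have "X $$ (p div n, p mod n) = v $ p" by (simp add: X_def)
      then show ?thesis using \<open>X = 0\<^sub>m n n\<close> \<open>p div n < n\<close> \<open>p mod n < n\<close> by simp
    qed
    then show False using v by auto
  qed
  moreover have "\<Phi> X = z \<cdot>\<^sub>m X"
  proof (rule eq_matI)
    have \<Phi>X: "\<Phi> X \<in> carrier_mat n n" using M X by (simp add: superop_matrix_def)
    then show "dim_row (\<Phi> X) = dim_row (z \<cdot>\<^sub>m X)" "dim_col (\<Phi> X) = dim_col (z \<cdot>\<^sub>m X)" using X by auto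
    fix a b assume "a < dim_row (z \<cdot>\<^sub>m X)" "b < dim_col (z \<cdot>\<^sub>m X)"
    then have ab: "a < n" "b < n" using X by auto
    have "\<Phi> X $$ (a, b) = (\<Sum>c<n. \<Sum>d<n. M $$ (a * n + b, c * n + d) * X $$ (c, d))"
      using M X ab by (simp add: superop_matrix_def)
    also have "\<dots> = (\<Sum>p<n * n. M $$ (a * n + b, p) * v $ p)"
      by (simp add: sum_product_index X_def)
    also have "\<dots> = (M *\<^sub>v v) $ (a * n + b)"
      using C v(1) product_index_less[OF ab] by (simp add: scalar_prod_def atLeast0LessThan)
    finally show "\<Phi> X $$ (a, b) = (z \<cdot>\<^sub>m X) $$ (a, b)"
      using v ab product_index_less[OF ab] by (simp add: X_def)
  qed
  ultimately show ?thesis using that X z by blast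
qed

section \<open>The trace of a Lindblad operator\<close>

lemma psd_form_nonneg:
  fixes v :: "nat \<Rightarrow> complex"
  assumes G: "psd_mat m G"
  shows "0 \<le> (\<Sum>i<m. \<Sum>j<m. G $$ (i, j) * v i * cnj (v j))"
proof -
  \<comment> \<open>The inner product puts the conjugate on the row index of \<open>G\<close>, while
    in the Lindblad form the row index belongs to the unconjugated factor; hence the conjugated
    vector.\<close>
  define w where "w = vec m (\<lambda>i. cnj (v i))"
  have C: "G \<in> carrier_mat m m" using G by (simp add: psd_mat_def hermitian_mat_def)
  have "0 \<le> (G *\<^sub>v w) \<bullet>c w" using G by (simp add: psd_mat_def w_def)
  also have "(G *\<^sub>v w) \<bullet>c w = (\<Sum>i<m. \<Sum>j<m. G $$ (i, j) * v i * cnj (v j))"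
    using C by (auto simp: scalar_prod_def atLeast0LessThan w_def sum_distrib_left sum_distrib_right mult_ac intro!: sum.cong)
  finally show ?thesis .
qed

text \<open>A zero of a nonnegative form is a minimum. Moving from \<open>v\<close> in the direction
  \<open>- y\<close>, where \<open>y\<close> is the vector to be shown zero, would decrease the form
  to first order unless \<open>y = 0\<close>.\<close>

lemma psd_form_zero_imp_kernel:
  fixes v :: "nat \<Rightarrow> complex"
  assumes G: "psd_mat m G" and zero: "(\<Sum>i<m. \<Sum>j<m. G $$ (i, j) * v i * cnj (v j)) = 0"
    and j: "j < m"
  shows "(\<Sum>i<m. G $$ (i, j) * v i) = 0"
proof -
  have herm: "cnj (G $$ (i, j)) = G $$ (j, i)" if "i < m" "j < m" for i j
    using G that hermitian_mat_index by (auto simp: psd_mat_def)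
  define B where "B u w = (\<Sum>i<m. \<Sum>j<m. G $$ (i, j) * u i * cnj (w j))" for u w
  have B_cnj: "cnj (B u w) = B w u" for u w
  proof -
    have "cnj (B u w) = (\<Sum>i<m. \<Sum>j<m. G $$ (j, i) * w j * cnj (u i))"
      by (auto simp: B_def herm mult_ac intro!: sum.cong)
    then show ?thesis by (simp add: B_def) (subst sum.swap, simp)
  qed
  \<comment> \<open>\<open>y\<close> is the transpose of \<open>G\<close> applied to
    \<open>v\<close>. Its squared norm \<open>N\<close> equals \<open>B v y\<close>, so it is the
    coefficient of the linear term of the form along \<open>v - r y\<close>.\<close>
  define y where "y j = (\<Sum>i<m. G $$ (i, j) * v i)" for j
  define N where "N = (\<Sum>j<m. (cmod (y j))\<^sup>2)"
  have N0: "N \<ge> 0" unfolding N_def by (intro sum_nonneg) auto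
  have Bvy: "B v y = complex_of_real N"
  proof -
    have "B v y = (\<Sum>j<m. \<Sum>i<m. G $$ (i, j) * v i * cnj (y j))"
      unfolding B_def by (rule sum.swap)
    also have "\<dots> = (\<Sum>j<m. y j * cnj (y j))" by (simp add: y_def sum_distrib_right)
    finally show ?thesis by (simp only: N_def of_real_sum complex_norm_square)
  qed
  have Byv: "B y v = complex_of_real N" using B_cnj[of v y] Bvy by simp
  define c where "c = Re (B y y)"
  have c0: "c \<ge> 0" using psd_form_nonneg[OF G, of y] by (simp add: c_def B_def less_eq_complex_def)
  have quad: "0 \<le> - 2 * r * N + r\<^sup>2 * c" for r :: real
  proof -
    have "B (\<lambda>i. v i - complex_of_real r * y i) (\<lambda>i. v i - complex_of_real r * y i) =
        B v v - complex_of_real r * B v y - complex_of_real r * B y v + (complex_of_real r)\<^sup>2 * B y y"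
      by (simp add: B_def sum_distrib_left sum_subtractf[symmetric] sum.distrib[symmetric] algebra_simps power2_eq_square)
    also have "B v v = 0" using zero by (simp add: B_def)
    finally have "Re (B (\<lambda>i. v i - complex_of_real r * y i) (\<lambda>i. v i - complex_of_real r * y i)) = - 2 * r * N + r\<^sup>2 * c"
      by (simp add: Bvy Byv c_def power2_eq_square)
    then show ?thesis
      using psd_form_nonneg[OF G, of "\<lambda>i. v i - complex_of_real r * y i"]
      by (simp add: B_def less_eq_complex_def)
  qed
  have "N = 0"
  proof (rule ccontr)
    assume "N \<noteq> 0"
    then have N: "N > 0" using N0 by simp
    \<comment> \<open>Nonnegativity gives \<open>2 * N \<le> r * c\<close> for \<open>r > 0\<close>,
      and this choice makes \<open>r * c = N - r\<close>, a contradiction. The added 1 covers the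
      case \<open>c = 0\<close>.\<close>
    define r where "r = N / (c + 1)"
    have r: "r > 0" "r * (c + 1) = N" using N c0 by (auto simp: r_def)
    have "r * (2 * N) \<le> r * (r * c)" using quad[of r] by (simp add: power2_eq_square)
    then have "2 * N \<le> r * c" using r by simp
    also have "\<dots> = N - r" using r(2) by (simp add: algebra_simps)
    finally show False using N r by simp
  qed
  then have "\<forall>j\<in>{..<m}. (cmod (y j))\<^sup>2 = 0" unfolding N_def by (subst (asm) sum_nonneg_eq_0_iff) auto
  then show ?thesis using j by (simp add: y_def)
qed

section \<open>Entry formulas for Lindblad operators\<close>

text \<open>The coefficient of \<open>\<rho> $$ (c, d)\<close> in the entry \<open>(a, b)\<close> of
  the sum of \<open>G i j\<close> times \<open>F i * \<rho> * mat_adjoint (F j)\<close>. Summing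
  \<open>kraus_kernel m G F e c e a\<close> over \<open>e\<close> gives the entry
  \<open>(a, c)\<close> of the operator in the anticommutator.\<close>

definition kraus_kernel :: "nat \<Rightarrow> complex mat \<Rightarrow> (nat \<Rightarrow> complex mat) \<Rightarrow> nat \<Rightarrow> nat \<Rightarrow> nat \<Rightarrow> nat \<Rightarrow> complex" where
  "kraus_kernel m G F a c b d = (\<Sum>i<m. \<Sum>j<m. G $$ (i, j) * F i $$ (a, c) * cnj (F j $$ (b, d)))"

text \<open>The dissipator depends on \<open>G\<close> and the \<open>F i\<close> through
  \<open>kraus_kernel\<close> alone; the facts \<open>D1\<close> to \<open>D3\<close> move the sums
  over \<open>i\<close> and \<open>j\<close> innermost to show this for its three terms.\<close>

lemma lindblad_form_index:
  assumes H0: "H0 \<in> carrier_mat n n" and F: "\<forall>i<m. F i \<in> carrier_mat n n"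
    and \<rho>: "\<rho> \<in> carrier_mat n n" and ab: "a < n" "b < n"
  shows "lindblad_form n m H0 G F \<rho> $$ (a, b) =
    \<i> * ((\<Sum>d<n. \<rho> $$ (a, d) * H0 $$ (d, b)) - (\<Sum>c<n. H0 $$ (a, c) * \<rho> $$ (c, b))) +
    ((\<Sum>c<n. \<Sum>d<n. kraus_kernel m G F a c b d * \<rho> $$ (c, d)) -
     (1/2) * ((\<Sum>c<n. (\<Sum>e<n. kraus_kernel m G F e c e a) * \<rho> $$ (c, b)) +
              (\<Sum>d<n. (\<Sum>e<n. kraus_kernel m G F e b e d) * \<rho> $$ (a, d))))"
proof -
  note F' = F[rule_format]
  have 1: "(F i * \<rho> * mat_adjoint (F j)) $$ (a, b) =
      (\<Sum>c<n. \<Sum>d<n. F i $$ (a, c) * cnj (F j $$ (b, d)) * \<rho> $$ (c, d))" if "i < m" "j < m" for i j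
    using \<rho> ab F'[OF that(1)] F'[OF that(2)] mat_adjoint_carrier[OF F'[OF that(2)]]
    by (subst mult_mat3_index[of _ n n _ n _ n]) (auto simp: mult_ac intro!: sum.cong)
  have 2: "(mat_adjoint (F j) * F i * \<rho>) $$ (a, b) =
      (\<Sum>c<n. \<Sum>e<n. F i $$ (e, c) * cnj (F j $$ (e, a)) * \<rho> $$ (c, b))" if "i < m" "j < m" for i j
    using \<rho> ab F'[OF that(1)] F'[OF that(2)] mat_adjoint_carrier[OF F'[OF that(2)]]
    by (subst mult_mat3_index[of _ n n _ n _ n], simp_all add: mult_ac, subst sum.swap) (rule refl)
  have 3: "(\<rho> * (mat_adjoint (F j) * F i)) $$ (a, b) =
      (\<Sum>d<n. \<Sum>e<n. F i $$ (e, b) * cnj (F j $$ (e, d)) * \<rho> $$ (a, d))" if "i < m" "j < m" for i j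
    using \<rho> ab F'[OF that(1)] F'[OF that(2)] mat_adjoint_carrier[OF F'[OF that(2)]]
    by (subst assoc_mult_mat[symmetric, of _ n n _ n _ n]; (subst mult_mat3_index[of _ n n _ n _ n])?)
       (auto simp: mult_ac intro!: sum.cong)
  have e: "(G $$ (i, j) \<cdot>\<^sub>m (F i * \<rho> * mat_adjoint (F j) -
          (1/2) \<cdot>\<^sub>m (mat_adjoint (F j) * F i * \<rho> + \<rho> * (mat_adjoint (F j) * F i)))) $$ (a, b) =
     G $$ (i, j) * ((F i * \<rho> * mat_adjoint (F j)) $$ (a, b) -
       (1/2) * ((mat_adjoint (F j) * F i * \<rho>) $$ (a, b) + (\<rho> * (mat_adjoint (F j) * F i)) $$ (a, b)))"
    if "i < m" "j < m" for i j
    using \<rho> ab F'[OF that(1)] F'[OF that(2)] mat_adjoint_carrier[OF F'[OF that(2)]]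
    by (simp del: index_mult_mat(1))
  have D1: "(\<Sum>i<m. \<Sum>j<m. G $$ (i, j) * (\<Sum>c<n. \<Sum>d<n. F i $$ (a, c) * cnj (F j $$ (b, d)) * \<rho> $$ (c, d))) =
      (\<Sum>c<n. \<Sum>d<n. kraus_kernel m G F a c b d * \<rho> $$ (c, d))"
    unfolding kraus_kernel_def sum_distrib_left sum_distrib_right
    by (simp only: sum.swap[of _ "{..<n}" "{..<m}"] mult.assoc)
  have D2: "(\<Sum>i<m. \<Sum>j<m. G $$ (i, j) * (\<Sum>c<n. \<Sum>e<n. F i $$ (e, c) * cnj (F j $$ (e, a)) * \<rho> $$ (c, b))) =
      (\<Sum>c<n. (\<Sum>e<n. kraus_kernel m G F e c e a) * \<rho> $$ (c, b))"
    unfolding kraus_kernel_def sum_distrib_left sum_distrib_right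
    by (simp only: sum.swap[of _ "{..<n}" "{..<m}"] mult.assoc)
  have D3: "(\<Sum>i<m. \<Sum>j<m. G $$ (i, j) * (\<Sum>d<n. \<Sum>e<n. F i $$ (e, b) * cnj (F j $$ (e, d)) * \<rho> $$ (a, d))) =
      (\<Sum>d<n. (\<Sum>e<n. kraus_kernel m G F e b e d) * \<rho> $$ (a, d))"
    unfolding kraus_kernel_def sum_distrib_left sum_distrib_right
    by (simp only: sum.swap[of _ "{..<n}" "{..<m}"] mult.assoc)
  have "lindblad_form n m H0 G F \<rho> $$ (a, b) =
    \<i> * ((\<rho> * H0) $$ (a, b) - (H0 * \<rho>) $$ (a, b)) +
    (\<Sum>i<m. \<Sum>j<m. (G $$ (i, j) \<cdot>\<^sub>m (F i * \<rho> * mat_adjoint (F j) -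
          (1/2) \<cdot>\<^sub>m (mat_adjoint (F j) * F i * \<rho> + \<rho> * (mat_adjoint (F j) * F i)))) $$ (a, b))"
    using \<rho> H0 ab by (simp add: lindblad_form_def del: index_mult_mat(1))
  also have "(\<rho> * H0) $$ (a, b) = (\<Sum>d<n. \<rho> $$ (a, d) * H0 $$ (d, b))"
    using \<rho> H0 ab by (rule mult_mat_index)
  also have "(H0 * \<rho>) $$ (a, b) = (\<Sum>c<n. H0 $$ (a, c) * \<rho> $$ (c, b))"
    using H0 \<rho> ab by (rule mult_mat_index)
  also have "(\<Sum>i<m. \<Sum>j<m. (G $$ (i, j) \<cdot>\<^sub>m (F i * \<rho> * mat_adjoint (F j) -
          (1/2) \<cdot>\<^sub>m (mat_adjoint (F j) * F i * \<rho> + \<rho> * (mat_adjoint (F j) * F i)))) $$ (a, b)) =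
    (\<Sum>i<m. \<Sum>j<m. G $$ (i, j) * (\<Sum>c<n. \<Sum>d<n. F i $$ (a, c) * cnj (F j $$ (b, d)) * \<rho> $$ (c, d)) -
       (1/2) * (G $$ (i, j) * (\<Sum>c<n. \<Sum>e<n. F i $$ (e, c) * cnj (F j $$ (e, a)) * \<rho> $$ (c, b)) +
                G $$ (i, j) * (\<Sum>d<n. \<Sum>e<n. F i $$ (e, b) * cnj (F j $$ (e, d)) * \<rho> $$ (a, d))))"
    by (intro sum.cong refl) (simp only: e 1 2 3 lessThan_iff right_diff_distrib distrib_left mult.left_commute)
  also have "\<dots> = (\<Sum>c<n. \<Sum>d<n. kraus_kernel m G F a c b d * \<rho> $$ (c, d)) -
     (1/2) * ((\<Sum>c<n. (\<Sum>e<n. kraus_kernel m G F e c e a) * \<rho> $$ (c, b)) +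
              (\<Sum>d<n. (\<Sum>e<n. kraus_kernel m G F e b e d) * \<rho> $$ (a, d)))"
    by (simp only: sum_subtractf sum.distrib sum_distrib_left[symmetric] D1 D2 D3)
  finally show ?thesis .
qed

lemma lindblad_form_carrier:
  "H0 \<in> carrier_mat n n \<Longrightarrow> \<rho> \<in> carrier_mat n n \<Longrightarrow> lindblad_form n m H0 G F \<rho> \<in> carrier_mat n n"
  by (simp add: lindblad_form_def)

text \<open>The coefficient of \<open>\<rho> $$ (c, d)\<close> in the entry \<open>(a, b)\<close> of
  the Lindblad form. Right multiplication of \<open>\<rho>\<close> preserves the row, hence
  \<open>a = c\<close>; left multiplication preserves the column, hence
  \<open>b = d\<close>.\<close>

definition lindblad_kernel :: "nat \<Rightarrow> nat \<Rightarrow> complex mat \<Rightarrow> complex mat \<Rightarrow> (nat \<Rightarrow> complex mat) \<Rightarrow> nat \<Rightarrow> nat \<Rightarrow> nat \<Rightarrow> nat \<Rightarrow> complex" where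
  "lindblad_kernel n m H0 G F a b c d =
     \<i> * ((if a = c then H0 $$ (d, b) else 0) - (if b = d then H0 $$ (a, c) else 0)) +
     (kraus_kernel m G F a c b d - (1/2) *
        ((if b = d then \<Sum>e<n. kraus_kernel m G F e c e a else 0) + (if a = c then \<Sum>e<n. kraus_kernel m G F e b e d else 0)))"

definition lindblad_matrix :: "nat \<Rightarrow> nat \<Rightarrow> complex mat \<Rightarrow> complex mat \<Rightarrow> (nat \<Rightarrow> complex mat) \<Rightarrow> complex mat" where
  "lindblad_matrix n m H0 G F = mat (n * n) (n * n) (\<lambda>(p, q). lindblad_kernel n m H0 G F (p div n) (p mod n) (q div n) (q mod n))"

lemma lindblad_matrix_index:
  assumes "a < n" "b < n" "c < n" "d < n"
  shows "lindblad_matrix n m H0 G F $$ (a * n + b, c * n + d) = lindblad_kernel n m H0 G F a b c d"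
  using assms by (simp add: lindblad_matrix_def product_index_less)

lemma superop_matrix_lindblad_form:
  assumes H0: "H0 \<in> carrier_mat n n" and F: "\<forall>i<m. F i \<in> carrier_mat n n"
  shows "superop_matrix n (lindblad_matrix n m H0 G F) (lindblad_form n m H0 G F)"
  unfolding superop_matrix_def
proof (intro conjI ballI allI impI)
  show "lindblad_matrix n m H0 G F \<in> carrier_mat (n * n) (n * n)" by (simp add: lindblad_matrix_def)
  fix X :: "complex mat" assume X: "X \<in> carrier_mat n n"
  show "lindblad_form n m H0 G F X \<in> carrier_mat n n" using H0 X by (rule lindblad_form_carrier)
  fix a b assume ab: "a < n" "b < n"
  have row: "(\<Sum>c<n. \<Sum>d<n. (if a = c then f d else 0) * X $$ (c, d)) = (\<Sum>d<n. f d * X $$ (a, d))" for f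
  proof -
    have "(\<Sum>c<n. \<Sum>d<n. (if a = c then f d else 0) * X $$ (c, d)) =
      (\<Sum>c<n. if a = c then \<Sum>d<n. f d * X $$ (c, d) else 0)"
      by (intro sum.cong refl) auto
    then show ?thesis using ab by (simp add: sum_delta_mult)
  qed
  have col: "(\<Sum>c<n. \<Sum>d<n. (if b = d then f c else 0) * X $$ (c, d)) = (\<Sum>c<n. f c * X $$ (c, b))" for f
  proof (intro sum.cong refl)
    fix c
    have "(\<Sum>d<n. (if b = d then f c else 0) * X $$ (c, d)) = (\<Sum>d<n. if b = d then f c * X $$ (c, d) else 0)"
      by (intro sum.cong refl) auto
    then show "(\<Sum>d<n. (if b = d then f c else 0) * X $$ (c, d)) = f c * X $$ (c, b)"
      using ab by (simp add: sum_delta_mult)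
  qed
  have "(\<Sum>c<n. \<Sum>d<n. lindblad_matrix n m H0 G F $$ (a * n + b, c * n + d) * X $$ (c, d)) =
      (\<Sum>c<n. \<Sum>d<n. lindblad_kernel n m H0 G F a b c d * X $$ (c, d))"
    using ab by (simp add: lindblad_matrix_index)
  also have "\<dots> = \<i> * ((\<Sum>c<n. \<Sum>d<n. (if a = c then H0 $$ (d, b) else 0) * X $$ (c, d)) -
        (\<Sum>c<n. \<Sum>d<n. (if b = d then H0 $$ (a, c) else 0) * X $$ (c, d))) +
      ((\<Sum>c<n. \<Sum>d<n. kraus_kernel m G F a c b d * X $$ (c, d)) - (1/2) *
       ((\<Sum>c<n. \<Sum>d<n. (if b = d then \<Sum>e<n. kraus_kernel m G F e c e a else 0) * X $$ (c, d)) +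
        (\<Sum>c<n. \<Sum>d<n. (if a = c then \<Sum>e<n. kraus_kernel m G F e b e d else 0) * X $$ (c, d))))"
    unfolding lindblad_kernel_def
    by (simp only: distrib_right left_diff_distrib mult.assoc sum.distrib sum_subtractf sum_distrib_left[symmetric])
  also have "\<dots> = lindblad_form n m H0 G F X $$ (a, b)"
    unfolding row col lindblad_form_index[OF H0 F X ab] by (simp only: mult.commute)
  finally show "lindblad_form n m H0 G F X $$ (a, b) =
    (\<Sum>c<n. \<Sum>d<n. lindblad_matrix n m H0 G F $$ (a * n + b, c * n + d) * X $$ (c, d))" by simp
qed

text \<open>Left and right multiplication by \<open>H0\<close> both have trace \<open>n\<close>
  times that of \<open>H0\<close>, so the commutator contributes nothing. The two halves of the
  anticommutator agree in the same way and use up the factor \<open>1/2\<close>.\<close>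

lemma mat_trace_lindblad_matrix:
  "mat_trace (lindblad_matrix n m H0 G F) =
     (\<Sum>a<n. \<Sum>b<n. kraus_kernel m G F a a b b) - of_nat n * (\<Sum>a<n. \<Sum>e<n. kraus_kernel m G F e a e a)"
proof -
  have "mat_trace (lindblad_matrix n m H0 G F) = (\<Sum>a<n. \<Sum>b<n. lindblad_kernel n m H0 G F a b a b)"
    by (simp add: mat_trace_def lindblad_matrix_def sum_product_index product_index_less)
  also have "\<dots> = \<i> * ((\<Sum>a<n. \<Sum>b<n. H0 $$ (b, b)) - (\<Sum>a<n. \<Sum>b<n. H0 $$ (a, a))) +
     ((\<Sum>a<n. \<Sum>b<n. kraus_kernel m G F a a b b) - (1/2) *
       ((\<Sum>a<n. \<Sum>b<n. \<Sum>e<n. kraus_kernel m G F e a e a) + (\<Sum>a<n. \<Sum>b<n. \<Sum>e<n. kraus_kernel m G F e b e b)))"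
    unfolding lindblad_kernel_def
    by (simp only: if_True refl sum.distrib sum_subtractf sum_distrib_left[symmetric])
  also have "\<dots> = (\<Sum>a<n. \<Sum>b<n. kraus_kernel m G F a a b b) - of_nat n * (\<Sum>a<n. \<Sum>e<n. kraus_kernel m G F e a e a)"
    by (simp add: sum_distrib_left[symmetric])
  finally show ?thesis .
qed

section \<open>Traceless parts and vanishing dissipators\<close>

definition mean_diag :: "nat \<Rightarrow> (nat \<Rightarrow> complex mat) \<Rightarrow> nat \<Rightarrow> complex" where
  "mean_diag n F i = (\<Sum>a<n. F i $$ (a, a)) / of_nat n"

text \<open>The index \<open>i\<close> comes last so that, for a fixed entry \<open>(a, b)\<close>,
  this is a vector on which the quadratic form of \<open>G\<close> can be evaluated.\<close>

definition traceless_part :: "nat \<Rightarrow> (nat \<Rightarrow> complex mat) \<Rightarrow> nat \<Rightarrow> nat \<Rightarrow> nat \<Rightarrow> complex" where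
  "traceless_part n F a b i = F i $$ (a, b) - (if a = b then mean_diag n F i else 0)"

text \<open>Scalar matrices are orthogonal to traceless ones in the Hilbert-Schmidt inner product,
  so removing the scalar parts subtracts exactly their inner product.\<close>

lemma traceless_part_inner:
  assumes n: "n > 0"
  shows "of_nat n * (\<Sum>a<n. \<Sum>b<n. traceless_part n F a b i * cnj (traceless_part n F a b j)) =
    of_nat n * (\<Sum>a<n. \<Sum>b<n. F i $$ (a, b) * cnj (F j $$ (a, b))) -
    (\<Sum>a<n. \<Sum>b<n. F i $$ (a, a) * cnj (F j $$ (b, b)))"
proof -
  have T: "(\<Sum>a<n. F i $$ (a, a)) = of_nat n * mean_diag n F i" for i
    using n by (simp add: mean_diag_def)
  have T': "(\<Sum>a<n. cnj (F j $$ (a, a))) = of_nat n * cnj (mean_diag n F j)"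
    using arg_cong[OF T[of j], of cnj] by simp
  have "(\<Sum>b<n. traceless_part n F a b i * cnj (traceless_part n F a b j)) =
     (\<Sum>b<n. F i $$ (a, b) * cnj (F j $$ (a, b))) - mean_diag n F i * cnj (F j $$ (a, a))
       - cnj (mean_diag n F j) * F i $$ (a, a) + mean_diag n F i * cnj (mean_diag n F j)" if "a < n" for a
  proof -
    have "(\<Sum>b<n. traceless_part n F a b i * cnj (traceless_part n F a b j)) =
      (\<Sum>b<n. F i $$ (a, b) * cnj (F j $$ (a, b)) +
        (if a = b then - mean_diag n F i * cnj (F j $$ (a, b)) - cnj (mean_diag n F j) * F i $$ (a, b)
           + mean_diag n F i * cnj (mean_diag n F j) else 0))"
      by (intro sum.cong refl) (simp add: traceless_part_def algebra_simps)
    then show ?thesis using that by (simp add: sum.distrib)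
  qed
  then have "(\<Sum>a<n. \<Sum>b<n. traceless_part n F a b i * cnj (traceless_part n F a b j)) =
     (\<Sum>a<n. \<Sum>b<n. F i $$ (a, b) * cnj (F j $$ (a, b))) - of_nat n * mean_diag n F i * cnj (mean_diag n F j)"
    by (simp add: sum.distrib sum_subtractf sum_distrib_left[symmetric] T T')
  moreover have "(\<Sum>a<n. \<Sum>b<n. F i $$ (a, a) * cnj (F j $$ (b, b))) =
      of_nat n * of_nat n * mean_diag n F i * cnj (mean_diag n F j)"
    by (simp add: sum_distrib_left[symmetric] sum_distrib_right[symmetric] T T')
  ultimately show ?thesis by (simp only: right_diff_distrib mult.assoc)
qed

text \<open>Summed against \<open>G\<close>, the two terms on the right of
  \<open>traceless_part_inner\<close> are the anticommutator and jump contributions to the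
  trace.\<close>

lemma mat_trace_lindblad_matrix_traceless:
  assumes n: "n > 0"
  shows "mat_trace (lindblad_matrix n m H0 G F) = - of_nat n *
    (\<Sum>a<n. \<Sum>b<n. \<Sum>i<m. \<Sum>j<m. G $$ (i, j) * traceless_part n F a b i * cnj (traceless_part n F a b j))"
proof -
  have "of_nat n * (\<Sum>a<n. \<Sum>b<n. \<Sum>i<m. \<Sum>j<m. G $$ (i, j) * traceless_part n F a b i * cnj (traceless_part n F a b j)) =
     (\<Sum>i<m. \<Sum>j<m. G $$ (i, j) * (of_nat n * (\<Sum>a<n. \<Sum>b<n. traceless_part n F a b i * cnj (traceless_part n F a b j))))"
    unfolding sum_distrib_left by (simp only: sum.swap[of _ "{..<n}" "{..<m}"] mult_ac)
  also have "\<dots> = of_nat n * (\<Sum>i<m. \<Sum>j<m. G $$ (i, j) * (\<Sum>a<n. \<Sum>b<n. F i $$ (a, b) * cnj (F j $$ (a, b)))) -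
     (\<Sum>i<m. \<Sum>j<m. G $$ (i, j) * (\<Sum>a<n. \<Sum>b<n. F i $$ (a, a) * cnj (F j $$ (b, b))))"
    unfolding traceless_part_inner[OF n] right_diff_distrib sum_subtractf
    by (simp only: sum_distrib_left mult_ac)
  also have "(\<Sum>i<m. \<Sum>j<m. G $$ (i, j) * (\<Sum>a<n. \<Sum>b<n. F i $$ (a, a) * cnj (F j $$ (b, b)))) =
     (\<Sum>a<n. \<Sum>b<n. kraus_kernel m G F a a b b)"
    unfolding kraus_kernel_def sum_distrib_left by (simp only: sum.swap[of _ "{..<n}" "{..<m}"] mult.assoc)
  also have "(\<Sum>i<m. \<Sum>j<m. G $$ (i, j) * (\<Sum>a<n. \<Sum>b<n. F i $$ (a, b) * cnj (F j $$ (a, b)))) =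
     (\<Sum>b<n. \<Sum>a<n. kraus_kernel m G F a b a b)"
    unfolding kraus_kernel_def sum_distrib_left
    by (subst (3) sum.swap) (simp only: sum.swap[of _ "{..<n}" "{..<m}"] mult.assoc)
  finally show ?thesis unfolding mat_trace_lindblad_matrix by (simp add: algebra_simps)
qed

text \<open>The trace is \<open>- n\<close> times a sum of nonnegative numbers, so \<open>tr\<close>
  can hold only if all of them vanish. Splitting scalars off the \<open>F i\<close> would in general
  change the Hamiltonian, but the correction pairs scalar with traceless parts through
  \<open>G\<close>, and \<open>G\<close> annihilates the latter; hence the same \<open>H0\<close> on
  the right.\<close>

lemma lindblad_form_hamiltonian:
  assumes H0: "H0 \<in> carrier_mat n n" and F: "\<forall>i<m. F i \<in> carrier_mat n n"
    and G: "psd_mat m G" and tr: "Re (mat_trace (lindblad_matrix n m H0 G F)) \<ge> 0" and \<rho>: "\<rho> \<in> carrier_mat n n"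
  shows "lindblad_form n m H0 G F \<rho> = \<i> \<cdot>\<^sub>m (\<rho> * H0 - H0 * \<rho>)"
proof (rule eq_matI)
  fix a b assume "a < dim_row (\<i> \<cdot>\<^sub>m (\<rho> * H0 - H0 * \<rho>))" "b < dim_col (\<i> \<cdot>\<^sub>m (\<rho> * H0 - H0 * \<rho>))"
  then have ab: "a < n" "b < n" using \<rho> H0 by auto
  then have n: "n > 0" by simp
  define Q where "Q a b = (\<Sum>i<m. \<Sum>j<m. G $$ (i, j) * traceless_part n F a b i * cnj (traceless_part n F a b j))" for a b
  have Q0: "0 \<le> Q a b" for a b unfolding Q_def by (rule psd_form_nonneg[OF G])
  have "(\<Sum>a<n. \<Sum>b<n. Re (Q a b)) \<le> 0"
    using tr n unfolding mat_trace_lindblad_matrix_traceless[OF n] Q_def[symmetric]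
    by (simp add: mult_le_0_iff)
  then have Qz: "(\<Sum>a<n. \<Sum>b<n. Re (Q a b)) = 0"
    using Q0 by (intro antisym sum_nonneg) (auto simp: less_eq_complex_def)
  have Q: "Q x y = 0" if "x < n" "y < n" for x y
  proof -
    have "\<forall>x\<in>{..<n}. (\<Sum>y<n. Re (Q x y)) = 0"
      using Qz Q0 by (subst (asm) sum_nonneg_eq_0_iff) (auto simp: less_eq_complex_def intro!: sum_nonneg)
    then have "(\<Sum>y<n. Re (Q x y)) = 0" using that by simp
    then have "\<forall>y\<in>{..<n}. Re (Q x y) = 0"
      using Q0 by (subst (asm) sum_nonneg_eq_0_iff) (auto simp: less_eq_complex_def)
    then show ?thesis using that Q0[of x y] by (auto simp: less_eq_complex_def complex_eq_iff)
  qed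
  \<comment> \<open>Each entry vector of the traceless parts lies in the kernel of \<open>G\<close>, so for every \<open>j\<close> the
    operator \<open>\<Sum>i. G i j F i\<close> is the scalar \<open>g j\<close>, and the dissipator collapses to \<open>s \<rho> - s \<rho>\<close>.\<close>
  define g where "g j = (\<Sum>i<m. G $$ (i, j) * mean_diag n F i)" for j
  have left: "(\<Sum>i<m. G $$ (i, j) * F i $$ (x, y)) = (if x = y then g j else 0)"
    if "x < n" "y < n" "j < m" for x y j
    using psd_form_zero_imp_kernel[OF G Q[OF that(1,2), unfolded Q_def] that(3)]
    by (auto simp: traceless_part_def g_def right_diff_distrib sum_subtractf)
  have right: "(\<Sum>j<m. G $$ (i, j) * cnj (F j $$ (x, y))) = (if x = y then cnj (g i) else 0)"
    if "x < n" "y < n" "i < m" for x y i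
  proof -
    have "(\<Sum>j<m. G $$ (i, j) * cnj (F j $$ (x, y))) = cnj (\<Sum>j<m. G $$ (j, i) * F j $$ (x, y))"
      using G that hermitian_mat_index[of m G] by (auto simp: psd_mat_def intro!: sum.cong)
    then show ?thesis using left[OF that] by simp
  qed
  \<comment> \<open>Since \<open>G\<close> is hermitian, \<open>s\<close> is its quadratic form at
    the vector of mean diagonals.\<close>
  define s where "s = (\<Sum>i<m. mean_diag n F i * cnj (g i))"
  have S: "kraus_kernel m G F x z y w = (if x = z then if y = w then s else 0 else 0)"
    if "x < n" "z < n" "y < n" "w < n" for x z y w
  proof -
    have "kraus_kernel m G F x z y w = (\<Sum>j<m. (\<Sum>i<m. G $$ (i, j) * F i $$ (x, z)) * cnj (F j $$ (y, w)))"
      unfolding kraus_kernel_def by (subst sum.swap) (simp add: sum_distrib_right)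
    also have "\<dots> = (if x = z then \<Sum>j<m. g j * cnj (F j $$ (y, w)) else 0)"
      using that by (simp add: left)
    also have "(\<Sum>j<m. g j * cnj (F j $$ (y, w))) = (\<Sum>i<m. mean_diag n F i * (\<Sum>j<m. G $$ (i, j) * cnj (F j $$ (y, w))))"
      unfolding g_def sum_distrib_left sum_distrib_right by (subst sum.swap) (simp add: mult_ac)
    also have "\<dots> = (if y = w then s else 0)" using that by (simp add: right s_def)
    finally show ?thesis .
  qed
  have if_mult: "(if P then u else 0) * v = (if P then u * v else 0)" for P and u v :: complex
    by simp
  have 1: "(\<Sum>c<n. \<Sum>d<n. kraus_kernel m G F a c b d * \<rho> $$ (c, d)) = s * \<rho> $$ (a, b)"
  proof -
    have "(\<Sum>c<n. \<Sum>d<n. kraus_kernel m G F a c b d * \<rho> $$ (c, d)) =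
      (\<Sum>c<n. if a = c then (\<Sum>d<n. if b = d then s * \<rho> $$ (c, d) else 0) else 0)"
      using ab by (intro sum.cong refl) (simp add: S if_mult)
    then show ?thesis using ab by simp
  qed
  have 2: "(\<Sum>c<n. (\<Sum>e<n. kraus_kernel m G F e c e a) * \<rho> $$ (c, b)) = s * \<rho> $$ (a, b)"
    using ab by (simp add: S if_mult)
  have 3: "(\<Sum>d<n. (\<Sum>e<n. kraus_kernel m G F e b e d) * \<rho> $$ (a, d)) = s * \<rho> $$ (a, b)"
    using ab by (simp add: S if_mult)
  show "lindblad_form n m H0 G F \<rho> $$ (a, b) = (\<i> \<cdot>\<^sub>m (\<rho> * H0 - H0 * \<rho>)) $$ (a, b)"
    unfolding lindblad_form_index[OF H0 F \<rho> ab] 1 2 3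
    using \<rho> H0 ab by (simp add: mult_mat_index[OF \<rho> H0] mult_mat_index[OF H0 \<rho>] del: index_mult_mat(1))
qed (use lindblad_form_carrier[OF H0 \<rho>] \<rho> H0 in auto)

text \<open>Hides the representation of \<open>L\<close>. The Hamiltonian form stays conditional on
  the trace, because that condition is what the absence of decay will supply.\<close>

lemma lindblad_operator_hamiltonian:
  assumes L: "lindblad_operator n L"
  obtains M H0 where "superop_matrix n M L" "hermitian_mat n H0"
    "Re (mat_trace M) \<ge> 0 \<Longrightarrow> \<forall>\<rho>\<in>carrier_mat n n. L \<rho> = \<i> \<cdot>\<^sub>m (\<rho> * H0 - H0 * \<rho>)"
proof -
  obtain m H0 G F where H0: "hermitian_mat n H0" and G: "psd_mat m G" and F: "\<forall>i<m. F i \<in> carrier_mat n n"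
    and form: "\<And>\<rho>. \<rho> \<in> carrier_mat n n \<Longrightarrow> L \<rho> = lindblad_form n m H0 G F \<rho>"
    using L unfolding lindblad_operator_def by blast
  have C: "H0 \<in> carrier_mat n n" using H0 by (simp add: hermitian_mat_def)
  have "superop_matrix n (lindblad_matrix n m H0 G F) L"
    using superop_matrix_lindblad_form[OF C F, where G = G] form by (simp add: superop_matrix_def)
  moreover have "\<forall>\<rho>\<in>carrier_mat n n. L \<rho> = \<i> \<cdot>\<^sub>m (\<rho> * H0 - H0 * \<rho>)"
    if "Re (mat_trace (lindblad_matrix n m H0 G F)) \<ge> 0"
    using lindblad_form_hamiltonian[OF C F G that] form by simp
  ultimately show ?thesis using that H0 by blast
qed

section \<open>Dilations\<close>

text \<open>The vector is not assumed normalised, so that sums of basis vectors can be inserted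
  directly.\<close>

lemma rank_one_density_mat:
  fixes v :: "nat \<Rightarrow> complex"
  assumes c: "c < n" "v c \<noteq> 0"
  defines "s \<equiv> \<Sum>i<n. (cmod (v i))\<^sup>2"
  shows "density_mat n (mat n n (\<lambda>(i, j). v i * cnj (v j) / complex_of_real s))" and "s > 0"
proof -
  define \<rho> where "\<rho> = mat n n (\<lambda>(i, j). v i * cnj (v j) / complex_of_real s)"
  show s: "s > 0" unfolding s_def using c by (intro sum_pos2[of _ c]) auto
  have "hermitian_mat n \<rho>"
    unfolding hermitian_mat_def by (auto simp: \<rho>_def mat_adjoint_def mat_of_rows_index intro!: eq_matI)
  moreover have "0 \<le> (\<rho> *\<^sub>v w) \<bullet>c w" if w: "w \<in> carrier_vec n" for w
  proof -
    define z where "z = (\<Sum>i<n. v i * cnj (w $ i))"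
    have "(\<rho> *\<^sub>v w) \<bullet>c w = (\<Sum>i<n. (\<Sum>j<n. v i * cnj (v j) / complex_of_real s * w $ j) * cnj (w $ i))"
      using w by (simp add: scalar_prod_def atLeast0LessThan \<rho>_def)
    also have "\<dots> = (\<Sum>i<n. v i * cnj z / complex_of_real s * cnj (w $ i))"
      by (simp add: z_def sum_distrib_left sum_divide_distrib mult_ac)
    also have "\<dots> = (\<Sum>i<n. v i * cnj (w $ i)) * cnj z / complex_of_real s"
      by (simp add: sum_distrib_right sum_divide_distrib mult_ac del: cnj_sum) (simp add: sum_distrib_left sum_divide_distrib)
    also have "\<dots> = z * cnj z / complex_of_real s" by (simp add: z_def)
    also have "\<dots> = complex_of_real ((cmod z)\<^sup>2 / s)" by (simp add: complex_norm_square[symmetric])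
    finally show ?thesis using s by (simp add: less_eq_complex_def)
  qed
  moreover have "mat_trace \<rho> = 1"
  proof -
    have "mat_trace \<rho> = (\<Sum>i<n. v i * cnj (v i)) / complex_of_real s"
      by (simp add: mat_trace_def \<rho>_def sum_divide_distrib)
    also have "(\<Sum>i<n. v i * cnj (v i)) = complex_of_real s"
      by (simp only: s_def of_real_sum complex_norm_square)
    finally have "mat_trace \<rho> = complex_of_real s / complex_of_real s" .
    then show ?thesis using s by simp
  qed
  ultimately show "density_mat n (mat n n (\<lambda>(i, j). v i * cnj (v j) / complex_of_real s))"
    unfolding \<rho>_def[symmetric] by (simp add: density_mat_def psd_mat_def)
qed

text \<open>Polarisation: basis vectors give the diagonal of \<open>K\<close>, and vectors
  \<open>e\<^sub>c + w e\<^sub>d\<close> with \<open>w = 1\<close> and \<open>w = \<i>\<close> give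
  two independent equations for \<open>K c d\<close> and \<open>K d c\<close>.\<close>

lemma density_mat_separating:
  fixes K :: "nat \<Rightarrow> nat \<Rightarrow> complex"
  assumes K: "\<And>\<rho>. density_mat n \<rho> \<Longrightarrow> (\<Sum>c<n. \<Sum>d<n. K c d * \<rho> $$ (c, d)) = 0"
    and cd: "c < n" "d < n"
  shows "K c d = 0"
proof -
  have quad: "(\<Sum>x<n. \<Sum>y<n. K x y * (v x * cnj (v y))) = 0" if "e < n" "v e \<noteq> 0" for v e
  proof -
    define s where "s = (\<Sum>i<n. (cmod (v i))\<^sup>2)"
    have "(\<Sum>x<n. \<Sum>y<n. K x y * (v x * cnj (v y) / complex_of_real s)) = 0"
      using K[OF rank_one_density_mat(1)[of e n v, OF that]] by (simp add: s_def)
    then have "(\<Sum>x<n. \<Sum>y<n. K x y * (v x * cnj (v y))) / complex_of_real s = 0"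
      by (simp add: sum_divide_distrib)
    moreover have "s > 0" unfolding s_def using that by (rule rank_one_density_mat(2))
    ultimately show ?thesis by simp
  qed
  have if_mult: "(if P then u else 0) * v = (if P then u * v else 0)"
    "v * (if P then u else 0) = (if P then v * u else 0)"
    "cnj (if P then u else 0) = (if P then cnj u else 0)" for P and u v :: complex
    by auto
  have diag: "K e e = 0" if e: "e < n" for e
    using quad[OF e, of "\<lambda>x. if x = e then 1 else 0"] e by (simp add: if_mult)
  show ?thesis
  proof (cases "c = d")
    case False
    have "K c d * cnj w + w * K d c = 0" for w
    proof -
      define v where "v x = (if x = c then 1 else 0) + (if x = d then w else 0)" for x
      have "v x * cnj (v y) = (if x = c then if y = c then 1 else 0 else 0) +
        (if x = c then if y = d then cnj w else 0 else 0) + (if x = d then if y = c then w else 0 else 0) +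
        (if x = d then if y = d then w * cnj w else 0 else 0)" for x y
        using False by (auto simp: v_def)
      then have "(\<Sum>x<n. \<Sum>y<n. K x y * (v x * cnj (v y))) =
          (\<Sum>x<n. \<Sum>y<n. (if x = c then if y = c then K x y else 0 else 0)) +
          (\<Sum>x<n. \<Sum>y<n. (if x = c then if y = d then K x y * cnj w else 0 else 0)) +
          (\<Sum>x<n. \<Sum>y<n. (if x = d then if y = c then K x y * w else 0 else 0)) +
          (\<Sum>x<n. \<Sum>y<n. (if x = d then if y = d then K x y * (w * cnj w) else 0 else 0))"
        by (simp add: distrib_left if_mult sum.distrib cong del: if_weak_cong)
      moreover have "(\<Sum>x<n. \<Sum>y<n. (if x = p then if y = q then f x y else 0 else 0)) = f p q"
        if "p < n" "q < n" for p q and f :: "nat \<Rightarrow> nat \<Rightarrow> complex"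
      proof -
        have "(\<Sum>x<n. \<Sum>y<n. (if x = p then if y = q then f x y else 0 else 0)) =
          (\<Sum>x<n. if x = p then \<Sum>y<n. if y = q then f x y else 0 else 0)"
          by (intro sum.cong refl) auto
        then show ?thesis using that by simp
      qed
      moreover have "(\<Sum>x<n. \<Sum>y<n. K x y * (v x * cnj (v y))) = 0"
      proof -
        have "v c \<noteq> 0" using False by (simp add: v_def)
        then show ?thesis by (rule quad[OF cd(1)])
      qed
      ultimately show ?thesis using diag[OF cd(1)] diag[OF cd(2)] cd by (simp only: add_0 add_0_right mult_1 mult_1_right mult_zero_left) (simp only: mult.commute)
    qed
    from this[of 1] this[of \<i>] have "K c d + K d c = 0" "K c d * (- \<i>) + \<i> * K d c = 0" by auto
    then have "K d c = - K c d" "\<i> * (K d c - K c d) = 0" by (auto simp: algebra_simps eq_neg_iff_add_eq_0)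
    then show ?thesis by simp
  qed (use diag cd in simp)
qed

section \<open>Tensor products and partial traces\<close>

lemma tensor_mat_carrier [simp]:
  "A \<in> carrier_mat n n \<Longrightarrow> B \<in> carrier_mat d d \<Longrightarrow> tensor_mat A B \<in> carrier_mat (n * d) (n * d)"
  by (simp add: tensor_mat_def)

lemma tensor_mat_index:
  assumes "A \<in> carrier_mat n n" "B \<in> carrier_mat d d" "a < n" "b < n" "k < d" "l < d"
  shows "tensor_mat A B $$ (a * d + k, b * d + l) = A $$ (a, b) * B $$ (k, l)"
  using assms by (simp add: tensor_mat_def product_index_less)

text \<open>The coefficient of the state entry \<open>(c, f)\<close> in the entry
  \<open>(a, b)\<close> of the reduced evolution. It is a finite polynomial in the entries of
  \<open>U\<close> and \<open>W\<close>, so limits can be taken factor by factor.\<close>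

definition dilation_kernel :: "nat \<Rightarrow> complex mat \<Rightarrow> complex mat \<Rightarrow> complex mat \<Rightarrow> nat \<Rightarrow> nat \<Rightarrow> nat \<Rightarrow> nat \<Rightarrow> complex" where
  "dilation_kernel d \<rho>E U W a b c f =
     (\<Sum>k<d. \<Sum>e<d. \<Sum>g<d. U $$ (a * d + k, c * d + e) * \<rho>E $$ (e, g) * W $$ (f * d + g, b * d + k))"

lemma partial_trace_env_dilation:
  assumes U: "U \<in> carrier_mat (n * d) (n * d)" and W: "W \<in> carrier_mat (n * d) (n * d)"
    and E: "\<rho>E \<in> carrier_mat d d" and X: "X \<in> carrier_mat n n" and ab: "a < n" "b < n"
  shows "partial_trace_env n d (U * tensor_mat X \<rho>E * W) $$ (a, b) =
    (\<Sum>c<n. \<Sum>f<n. dilation_kernel d \<rho>E U W a b c f * X $$ (c, f))"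
proof -
  define g where "g k c e f h = U $$ (a * d + k, c * d + e) * \<rho>E $$ (e, h) * W $$ (f * d + h, b * d + k) * X $$ (c, f)" for k c e f h
  have g_tensor: "g k c e f h = U $$ (a * d + k, c * d + e) * (X $$ (c, f) * \<rho>E $$ (e, h)) * W $$ (f * d + h, b * d + k)" for k c e f h
    by (simp add: g_def)
  have "(U * tensor_mat X \<rho>E * W) $$ (a * d + k, b * d + k) =
     (\<Sum>c<n. \<Sum>e<d. \<Sum>f<n. \<Sum>h<d. g k c e f h)" if "k < d" for k
    using mult_mat3_index[OF U tensor_mat_carrier[OF X E] W product_index_less[OF ab(1) that] product_index_less[OF ab(2) that]]
    by (simp add: sum_product_index tensor_mat_index[OF X E] g_tensor)
  then have "partial_trace_env n d (U * tensor_mat X \<rho>E * W) $$ (a, b) =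
     (\<Sum>k<d. \<Sum>c<n. \<Sum>e<d. \<Sum>f<n. \<Sum>h<d. g k c e f h)"
    using ab by (simp add: partial_trace_env_def)
  also have "\<dots> = (\<Sum>c<n. \<Sum>k<d. \<Sum>f<n. \<Sum>e<d. \<Sum>h<d. g k c e f h)"
    by (subst sum.swap) (intro sum.cong refl sum.swap)
  also have "\<dots> = (\<Sum>c<n. \<Sum>f<n. \<Sum>k<d. \<Sum>e<d. \<Sum>h<d. g k c e f h)"
    by (intro sum.cong refl sum.swap)
  also have "\<dots> = (\<Sum>c<n. \<Sum>f<n. dilation_kernel d \<rho>E U W a b c f * X $$ (c, f))"
    by (simp only: dilation_kernel_def g_def sum_distrib_right)
  finally show ?thesis .
qed

text \<open>The limit of the reduced evolution along recurrence times: trivial dynamics returns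
  \<open>X\<close> because the environment state has trace 1.\<close>

lemma partial_trace_env_tensor:
  assumes E: "\<rho>E \<in> carrier_mat d d" "mat_trace \<rho>E = 1" and X: "X \<in> carrier_mat n n" and ab: "a < n" "b < n"
  shows "(\<Sum>c<n. \<Sum>f<n. dilation_kernel d \<rho>E (1\<^sub>m (n * d)) (1\<^sub>m (n * d)) a b c f * X $$ (c, f)) = X $$ (a, b)"
proof -
  have "(\<Sum>c<n. \<Sum>f<n. dilation_kernel d \<rho>E (1\<^sub>m (n * d)) (1\<^sub>m (n * d)) a b c f * X $$ (c, f)) =
      partial_trace_env n d (1\<^sub>m (n * d) * tensor_mat X \<rho>E * 1\<^sub>m (n * d)) $$ (a, b)"
    using E X ab by (intro partial_trace_env_dilation[symmetric]) auto
  also have "1\<^sub>m (n * d) * tensor_mat X \<rho>E * 1\<^sub>m (n * d) = tensor_mat X \<rho>E"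
    using tensor_mat_carrier[OF X E(1)] by simp
  also have "partial_trace_env n d (tensor_mat X \<rho>E) $$ (a, b) = X $$ (a, b) * mat_trace \<rho>E"
    using E X ab by (simp add: partial_trace_env_def tensor_mat_index[OF X E(1)] mat_trace_def sum_distrib_left[symmetric])
  finally show ?thesis using E by simp
qed

section \<open>Exclusion of decaying eigenvectors\<close>

lemma dilated_process_eigenvector_not_decaying:
  assumes M: "superop_matrix n M L" and E: "density_mat d \<rho>E" and H: "hermitian_mat (n * d) H"
    and dil: "\<And>\<rho> t. density_mat n \<rho> \<Longrightarrow> t \<ge> 0 \<Longrightarrow>
      quantum_process n L t \<rho> = partial_trace_env n d
        (mat_exp ((- \<i> * complex_of_real t) \<cdot>\<^sub>m H) * tensor_mat \<rho> \<rho>E * mat_exp ((\<i> * complex_of_real t) \<cdot>\<^sub>m H))"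
    and X: "X \<in> carrier_mat n n" and LX: "L X = z \<cdot>\<^sub>m X" and z: "Re z < 0"
  shows "X = 0\<^sub>m n n"
proof (rule eq_matI)
  fix a b assume "a < dim_row (0\<^sub>m n n)" "b < dim_col (0\<^sub>m n n)"
  then have ab: "a < n" "b < n" by auto
  define U where "U t = mat_exp ((- \<i> * complex_of_real t) \<cdot>\<^sub>m H)" for t
  define W where "W t = mat_exp ((\<i> * complex_of_real t) \<cdot>\<^sub>m H)" for t
  have HC: "H \<in> carrier_mat (n * d) (n * d)" using H by (simp add: hermitian_mat_def)
  have UC: "U t \<in> carrier_mat (n * d) (n * d)" and WC: "W t \<in> carrier_mat (n * d) (n * d)" for t
    using HC by (simp_all add: U_def W_def)
  have EC: "\<rho>E \<in> carrier_mat d d" "mat_trace \<rho>E = 1"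
    using E by (auto simp: density_mat_def psd_mat_def hermitian_mat_def)
  \<comment> \<open>Both sides of \<open>dil\<close> are linear in the entries of the state, so
    agreement on density matrices forces equal coefficients. This makes the equation available for
    \<open>X\<close>, which need not be a state.\<close>
  have kernel: "mat_exp (complex_of_real t \<cdot>\<^sub>m M) $$ (a * n + b, c * n + f) = dilation_kernel d \<rho>E (U t) (W t) a b c f"
    if "t \<ge> 0" "c < n" "f < n" for t c f
  proof -
    define K where "K c f = mat_exp (complex_of_real t \<cdot>\<^sub>m M) $$ (a * n + b, c * n + f) -
      dilation_kernel d \<rho>E (U t) (W t) a b c f" for c f
    have "(\<Sum>c<n. \<Sum>f<n. K c f * \<rho> $$ (c, f)) = 0" if \<rho>: "density_mat n \<rho>" for \<rho>
    proof -
      have C: "\<rho> \<in> carrier_mat n n" using \<rho> by (auto simp: density_mat_def psd_mat_def hermitian_mat_def)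
      show ?thesis
        using dil[OF \<rho> \<open>t \<ge> 0\<close>] quantum_process_entry[OF M C ab, of t]
          partial_trace_env_dilation[OF UC WC EC(1) C ab, of t t]
        by (simp add: K_def left_diff_distrib sum_subtractf U_def W_def)
    qed
    then have "K c f = 0" using that(2,3) by (rule density_mat_separating)
    then show ?thesis by (simp add: K_def)
  qed
  have orbit: "exp (complex_of_real t * z) * X $$ (a, b) =
      (\<Sum>c<n. \<Sum>f<n. dilation_kernel d \<rho>E (U t) (W t) a b c f * X $$ (c, f))" if "t \<ge> 0" for t
    using quantum_process_entry[OF M X ab, of t] quantum_process_eigenvector[OF M X LX, of t] kernel[OF that] X ab
    by simp
  obtain q :: "nat \<Rightarrow> nat" where q: "\<And>k. q k \<ge> 1"
    and lim: "\<And>i j. i < n * d \<Longrightarrow> j < n * d \<Longrightarrow> (\<lambda>k. U (real (q k)) $$ (i, j)) \<longlonglongrightarrow> 1\<^sub>m (n * d) $$ (i, j)"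
    using mat_exp_recurrent[OF H] unfolding U_def by blast
  have limW: "(\<lambda>k. W (real (q k)) $$ (i, j)) \<longlonglongrightarrow> 1\<^sub>m (n * d) $$ (i, j)" if "i < n * d" "j < n * d" for i j
  proof -
    have "W t $$ (i, j) = cnj (U t $$ (j, i))" for t
      using mat_exp_unitary_group(1)[OF H, of t] mat_adjoint_index[of i "U t" j] UC[of t] that
      by (simp add: U_def W_def)
    moreover have "cnj (1\<^sub>m (n * d) $$ (j, i)) = 1\<^sub>m (n * d) $$ (i, j)" using that by auto
    ultimately show ?thesis using tendsto_cnj[OF lim[OF that(2,1)]] by simp
  qed
  have "(\<lambda>k. \<Sum>c<n. \<Sum>f<n. dilation_kernel d \<rho>E (U (real (q k))) (W (real (q k))) a b c f * X $$ (c, f)) \<longlonglongrightarrow>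
      (\<Sum>c<n. \<Sum>f<n. dilation_kernel d \<rho>E (1\<^sub>m (n * d)) (1\<^sub>m (n * d)) a b c f * X $$ (c, f))"
    unfolding dilation_kernel_def using ab
    by (intro tendsto_sum tendsto_mult tendsto_const lim limW) (auto intro: product_index_less)
  then have "(\<lambda>k. exp (complex_of_real (real (q k)) * z) * X $$ (a, b)) \<longlonglongrightarrow> X $$ (a, b)"
    by (simp only: orbit[OF of_nat_0_le_iff] partial_trace_env_tensor[OF EC X ab])
  then have "(\<lambda>k. cmod (exp (complex_of_real (real (q k)) * z) * X $$ (a, b))) \<longlonglongrightarrow> cmod (X $$ (a, b))"
    by (rule tendsto_norm)
  moreover have "cmod (exp (complex_of_real (real (q k)) * z) * X $$ (a, b)) \<le> exp (Re z) * cmod (X $$ (a, b))" for k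
  proof -
    \<comment> \<open>Here \<open>q k \<ge> 1\<close> matters: it bounds all members of the sequence
      by one factor below 1, which survives the limit.\<close>
    have "real (q k) * Re z \<le> 1 * Re z" using q[of k] z by (intro mult_right_mono_neg) auto
    then show ?thesis by (simp add: norm_mult mult_right_mono)
  qed
  ultimately have "cmod (X $$ (a, b)) \<le> exp (Re z) * cmod (X $$ (a, b))"
    by (intro LIMSEQ_le_const2) auto
  moreover have "exp (Re z) < 1" using z by simp
  ultimately have "cmod (X $$ (a, b)) = 0"
    using mult_strict_right_mono[of "exp (Re z)" 1 "cmod (X $$ (a, b))"] by (cases "X $$ (a, b) = 0") auto
  then show "X $$ (a, b) = 0\<^sub>m n n $$ (a, b)" using ab by simp
qed (use X in auto)

lemma unitary_process_eigenvector_not_decaying: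
  assumes M: "superop_matrix n M L" and U: "unitary_conjugation n (quantum_process n L 1)"
    and X: "X \<in> carrier_mat n n" and LX: "L X = z \<cdot>\<^sub>m X" and z: "Re z < 0"
  shows "X = 0\<^sub>m n n"
proof -
  obtain V where V: "unitary_mat n V" and conj: "quantum_process n L 1 X = V * X * mat_adjoint V"
    using U X by (auto simp: unitary_conjugation_def)
  have VC: "V \<in> carrier_mat n n" "mat_adjoint V \<in> carrier_mat n n" and VV: "mat_adjoint V * V = 1\<^sub>m n"
    using V by (auto simp: unitary_mat_def)
  define r where "r = exp z"
  define Y where "Y = V * X * mat_adjoint V"
  have X': "mat_adjoint X \<in> carrier_mat n n" using X by simp
  have YX: "Y = r \<cdot>\<^sub>m X" using quantum_process_eigenvector[OF M X LX, of 1] conj by (simp add: r_def Y_def)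
  have YC: "Y \<in> carrier_mat n n" using X by (simp add: YX)
  have hs: "mat_trace (mat_adjoint A * A) = complex_of_real (\<Sum>j<n. \<Sum>i<n. (cmod (A $$ (i, j)))\<^sup>2)"
    if A: "A \<in> carrier_mat n n" for A
    unfolding of_real_sum complex_norm_square mat_trace_def
    using A carrier_matD[OF mat_adjoint_carrier[OF A]]
    by (simp add: mult_mat_index[OF mat_adjoint_carrier[OF A] A] mult.commute del: index_mult_mat(1))
  have VX: "V * X \<in> carrier_mat n n" using VC X by (intro mult_carrier_mat[of _ n n]) auto
  have adjVX: "mat_adjoint (V * X) = mat_adjoint X * mat_adjoint V" by (rule mat_adjoint_mult[OF VC(1) X])
  have cancel: "mat_adjoint V * (V * B) = B" if "B \<in> carrier_mat n n" for B
    using VC VV that by (simp add: assoc_mult_mat[of _ n n _ n _ n, symmetric])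
  have adjY: "mat_adjoint Y = V * mat_adjoint (V * X)"
  proof -
    have "mat_adjoint (mat_adjoint V) = V"
      using VC by (intro eq_matI) (auto simp: mat_adjoint_def mat_of_rows_index)
    then show ?thesis unfolding Y_def by (simp add: mat_adjoint_mult[OF VX VC(2)])
  qed
  \<comment> \<open>In the order \<open>Y * mat_adjoint Y\<close> the inner pair of \<open>V\<close>
    cancels; after another cyclic exchange the outer pair becomes adjacent and cancels too. Hence
    \<open>Y\<close> and \<open>X\<close> have the same Hilbert-Schmidt norm.\<close>
  have "mat_trace (mat_adjoint Y * Y) = mat_trace (Y * mat_adjoint Y)"
    using X by (intro mat_trace_mult_comm[of _ n n]) (auto simp: YX)
  also have "Y * mat_adjoint Y = V * X * mat_adjoint (V * X)"
    unfolding adjY unfolding Y_def using VC VX mat_adjoint_carrier[OF VX]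
    by (simp add: assoc_mult_mat[of "V * X" n n "mat_adjoint V" n _ n] cancel)
  also have "mat_trace (V * X * mat_adjoint (V * X)) = mat_trace (mat_adjoint (V * X) * (V * X))"
    using VX mat_adjoint_carrier[OF VX] by (rule mat_trace_mult_comm)
  also have "mat_adjoint (V * X) * (V * X) = mat_adjoint X * X"
    unfolding adjVX using VC VX X X'
    by (simp add: assoc_mult_mat[of "mat_adjoint X" n n "mat_adjoint V" n "V * X" n] cancel)
  finally have "mat_trace (mat_adjoint Y * Y) = mat_trace (mat_adjoint X * X)" .
  then have "complex_of_real (\<Sum>j<n. \<Sum>i<n. (cmod (Y $$ (i, j)))\<^sup>2) = complex_of_real (\<Sum>j<n. \<Sum>i<n. (cmod (X $$ (i, j)))\<^sup>2)"
    unfolding hs[OF X] hs[OF YC] .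
  then have "(\<Sum>j<n. \<Sum>i<n. (cmod (Y $$ (i, j)))\<^sup>2) = (\<Sum>j<n. \<Sum>i<n. (cmod (X $$ (i, j)))\<^sup>2)"
    using of_real_eq_iff by blast
  moreover have "(\<Sum>j<n. \<Sum>i<n. (cmod (Y $$ (i, j)))\<^sup>2) = (cmod r)\<^sup>2 * (\<Sum>j<n. \<Sum>i<n. (cmod (X $$ (i, j)))\<^sup>2)"
    using X by (simp add: YX norm_mult power_mult_distrib sum_distrib_left)
  moreover have "(cmod r)\<^sup>2 \<noteq> 1" using z exp_gt_zero[of "Re z"] by (simp add: r_def power2_eq_1_iff del: exp_gt_zero)
  ultimately have zero: "(\<Sum>j<n. \<Sum>i<n. (cmod (X $$ (i, j)))\<^sup>2) = 0" by simp
  have "X $$ (i, j) = 0" if "i < n" "j < n" for i j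
  proof -
    have "\<forall>j\<in>{..<n}. (\<Sum>i<n. (cmod (X $$ (i, j)))\<^sup>2) = 0"
      using zero by (subst (asm) sum_nonneg_eq_0_iff) (auto intro!: sum_nonneg)
    then have "(\<Sum>i<n. (cmod (X $$ (i, j)))\<^sup>2) = 0" using that by simp
    then have "\<forall>i\<in>{..<n}. (cmod (X $$ (i, j)))\<^sup>2 = 0"
      by (subst (asm) sum_nonneg_eq_0_iff) auto
    then show ?thesis using that by simp
  qed
  then show ?thesis using X by (intro eq_matI) auto
qed

section \<open>Hamiltonian evolution and the two implications\<close>

text \<open>The commutator is a left multiplication plus a right multiplication, with opposite
  multiples of \<open>H\<close>.\<close>

lemma quantum_process_hamiltonian:
  assumes H: "H \<in> carrier_mat n n" and X: "X \<in> carrier_mat n n"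
    and L: "\<And>\<rho>. \<rho> \<in> carrier_mat n n \<Longrightarrow> L \<rho> = \<i> \<cdot>\<^sub>m (\<rho> * H - H * \<rho>)"
  shows "quantum_process n L t X =
    mat_exp ((- \<i> * complex_of_real t) \<cdot>\<^sub>m H) * X * mat_exp ((\<i> * complex_of_real t) \<cdot>\<^sub>m H)"
  unfolding quantum_process_def
proof (rule superop_exp_sum_of_multiplications)
  fix Y :: "complex mat" assume Y: "Y \<in> carrier_mat n n"
  have "(- \<i> * complex_of_real t) \<cdot>\<^sub>m H * Y + Y * ((\<i> * complex_of_real t) \<cdot>\<^sub>m H) =
      (- \<i> * complex_of_real t) \<cdot>\<^sub>m (H * Y) + (\<i> * complex_of_real t) \<cdot>\<^sub>m (Y * H)"
    using mult_smult_assoc_mat[OF H Y] mult_smult_distrib[OF Y H] by simp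
  then show "complex_of_real t \<cdot>\<^sub>m L Y = (- \<i> * complex_of_real t) \<cdot>\<^sub>m H * Y + Y * ((\<i> * complex_of_real t) \<cdot>\<^sub>m H)"
    using H Y by (intro eq_matI) (auto simp: L algebra_simps simp del: index_mult_mat(1))
qed (use H X in auto)

lemma density_mat_one: "density_mat 1 (1\<^sub>m 1)"
proof -
  have "0 \<le> ((1\<^sub>m 1 :: complex mat) *\<^sub>v v) \<bullet>c v" if "v \<in> carrier_vec 1" for v
    using that conjugate_square_ge_0_vec by simp
  then show ?thesis
    by (simp add: density_mat_def psd_mat_def hermitian_mat_def mat_adjoint_one mat_trace_def)
qed

text \<open>The common core of both implications. The Hamiltonian is the one in the Lindblad form,
  hence a single \<open>H\<close> for all \<open>t\<close>.\<close>

lemma quantum_process_without_decay: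
  assumes L: "lindblad_operator n L"
    and no_decay: "\<forall>X\<in>carrier_mat n n. \<forall>z. L X = z \<cdot>\<^sub>m X \<longrightarrow> Re z < 0 \<longrightarrow> X = 0\<^sub>m n n"
  shows "\<exists>H. hermitian_mat n H \<and> (\<forall>X\<in>carrier_mat n n. \<forall>t. quantum_process n L t X =
    mat_exp ((- \<i> * complex_of_real t) \<cdot>\<^sub>m H) * X * mat_exp ((\<i> * complex_of_real t) \<cdot>\<^sub>m H))"
proof -
  obtain M H where M: "superop_matrix n M L" and H: "hermitian_mat n H"
    and ham: "Re (mat_trace M) \<ge> 0 \<Longrightarrow> \<forall>\<rho>\<in>carrier_mat n n. L \<rho> = \<i> \<cdot>\<^sub>m (\<rho> * H - H * \<rho>)"
    using lindblad_operator_hamiltonian[OF L] by blast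
  have "Re (mat_trace M) \<ge> 0"
  proof (rule ccontr)
    assume "\<not> Re (mat_trace M) \<ge> 0"
    then have "Re (mat_trace M) < 0" by simp
    then show False
      by (rule superop_eigenvector_with_negative_real_part[OF M]) (use no_decay in blast)
  qed
  from ham[OF this] have "\<forall>X\<in>carrier_mat n n. \<forall>t. quantum_process n L t X =
      mat_exp ((- \<i> * complex_of_real t) \<cdot>\<^sub>m H) * X * mat_exp ((\<i> * complex_of_real t) \<cdot>\<^sub>m H)"
    using quantum_process_hamiltonian H by (simp add: hermitian_mat_def)
  with H show ?thesis by blast
qed

lemma dilation_imp_unitary_conjugation:
  assumes L: "lindblad_operator n L"
    and ex: "\<exists>d \<rho>E H. density_mat d \<rho>E \<and> hermitian_mat (n * d) H \<and>
      (\<forall>\<rho> t. density_mat n \<rho> \<longrightarrow> t \<ge> 0 \<longrightarrow>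
        quantum_process n L t \<rho> = partial_trace_env n d
          (mat_exp ((- \<i> * complex_of_real t) \<cdot>\<^sub>m H) * tensor_mat \<rho> \<rho>E * mat_exp ((\<i> * complex_of_real t) \<cdot>\<^sub>m H)))"
  shows "\<forall>t\<ge>0. unitary_conjugation n (quantum_process n L t)"
proof -
  obtain M where M: "superop_matrix n M L"
    using lindblad_operator_hamiltonian[OF L] by blast
  obtain d \<rho>E H where E: "density_mat d \<rho>E" and H: "hermitian_mat (n * d) H"
    and dil: "\<And>\<rho> t. density_mat n \<rho> \<Longrightarrow> t \<ge> 0 \<Longrightarrow> quantum_process n L t \<rho> = partial_trace_env n d
      (mat_exp ((- \<i> * complex_of_real t) \<cdot>\<^sub>m H) * tensor_mat \<rho> \<rho>E * mat_exp ((\<i> * complex_of_real t) \<cdot>\<^sub>m H))"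
    using ex by blast
  have no_decay: "\<forall>X\<in>carrier_mat n n. \<forall>z. L X = z \<cdot>\<^sub>m X \<longrightarrow> Re z < 0 \<longrightarrow> X = 0\<^sub>m n n"
    using dilated_process_eigenvector_not_decaying[OF M E H dil] by blast
  obtain K where K: "hermitian_mat n K" and process: "\<forall>X\<in>carrier_mat n n. \<forall>t. quantum_process n L t X =
      mat_exp ((- \<i> * complex_of_real t) \<cdot>\<^sub>m K) * X * mat_exp ((\<i> * complex_of_real t) \<cdot>\<^sub>m K)"
    using quantum_process_without_decay[OF L no_decay] by blast
  show ?thesis
    unfolding unitary_conjugation_def
  proof (intro allI impI)
    fix t
    show "\<exists>U. unitary_mat n U \<and> (\<forall>\<rho>\<in>carrier_mat n n. quantum_process n L t \<rho> = U * \<rho> * mat_adjoint U)"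
      by (intro exI[of _ "mat_exp ((- \<i> * complex_of_real t) \<cdot>\<^sub>m K)"] conjI ballI)
         (simp_all only: process mat_exp_unitary_group[OF K])
  qed
qed

lemma unitary_conjugation_imp_dilation:
  assumes L: "lindblad_operator n L" and unitary: "\<forall>t\<ge>0. unitary_conjugation n (quantum_process n L t)"
  shows "\<exists>d \<rho>E H. density_mat d \<rho>E \<and> hermitian_mat (n * d) H \<and>
      (\<forall>\<rho> t. density_mat n \<rho> \<longrightarrow> t \<ge> 0 \<longrightarrow>
        quantum_process n L t \<rho> = partial_trace_env n d
          (mat_exp ((- \<i> * complex_of_real t) \<cdot>\<^sub>m H) * tensor_mat \<rho> \<rho>E * mat_exp ((\<i> * complex_of_real t) \<cdot>\<^sub>m H)))"
proof -
  obtain M where M: "superop_matrix n M L"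
    using lindblad_operator_hamiltonian[OF L] by blast
  \<comment> \<open>A unitary conjugation at one positive time already excludes decay, and thereby
    determines the form of the process at every time.\<close>
  have "unitary_conjugation n (quantum_process n L 1)" using unitary by simp
  then have no_decay: "\<forall>X\<in>carrier_mat n n. \<forall>z. L X = z \<cdot>\<^sub>m X \<longrightarrow> Re z < 0 \<longrightarrow> X = 0\<^sub>m n n"
    using unitary_process_eigenvector_not_decaying[OF M] by blast
  obtain K where K: "hermitian_mat n K" and process: "\<forall>X\<in>carrier_mat n n. \<forall>t. quantum_process n L t X =
      mat_exp ((- \<i> * complex_of_real t) \<cdot>\<^sub>m K) * X * mat_exp ((\<i> * complex_of_real t) \<cdot>\<^sub>m K)"
    using quantum_process_without_decay[OF L no_decay] by blast
  \<comment> \<open>With a one-dimensional environment, tensoring with its only state and tracing it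
    out both do nothing.\<close>
  have "quantum_process n L t \<rho> = partial_trace_env n 1
      (mat_exp ((- \<i> * complex_of_real t) \<cdot>\<^sub>m K) * tensor_mat \<rho> (1\<^sub>m 1) * mat_exp ((\<i> * complex_of_real t) \<cdot>\<^sub>m K))"
    if "density_mat n \<rho>" for \<rho> t
  proof -
    have \<rho>: "\<rho> \<in> carrier_mat n n" using that by (auto simp: density_mat_def psd_mat_def hermitian_mat_def)
    have "tensor_mat \<rho> (1\<^sub>m 1) = \<rho>" using \<rho> by (intro eq_matI) (auto simp: tensor_mat_def)
    moreover have "partial_trace_env n 1 A = A" if "A \<in> carrier_mat n n" for A
      using that by (intro eq_matI) (auto simp: partial_trace_env_def)
    moreover have "mat_exp ((- \<i> * complex_of_real t) \<cdot>\<^sub>m K) * \<rho> * mat_exp ((\<i> * complex_of_real t) \<cdot>\<^sub>m K) \<in> carrier_mat n n"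
      using K \<rho> by (intro mult_carrier_mat[of _ n n]) (auto simp: hermitian_mat_def)
    ultimately show ?thesis using process \<rho> by simp
  qed
  \<comment> \<open>The witnesses are \<open>1\<close>, \<open>1\<^sub>m 1\<close> and
    \<open>K\<close>; rewriting \<open>n * 1\<close> to \<open>n\<close> matches the dimension of
    the Hamiltonian.\<close>
  then show ?thesis
    using density_mat_one K by (metis mult_1_right)
qed

theorem theorem2:
  fixes n :: nat and L :: "complex mat \<Rightarrow> complex mat"
  assumes "lindblad_operator n L"
  shows "(\<exists>d \<rho>E H. density_mat d \<rho>E \<and> hermitian_mat (n * d) H \<and>
            (\<forall>\<rho> t. density_mat n \<rho> \<longrightarrow> t \<ge> 0 \<longrightarrow>
               quantum_process n L t \<rho> =
                 partial_trace_env n d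
                   (mat_exp ((- \<i> * complex_of_real t) \<cdot>\<^sub>m H) * tensor_mat \<rho> \<rho>E *
                    mat_exp ((\<i> * complex_of_real t) \<cdot>\<^sub>m H))))
         \<longleftrightarrow> (\<forall>t\<ge>0. unitary_conjugation n (quantum_process n L t))"
    (is "?dilation \<longleftrightarrow> ?unitary")
proof
  show ?unitary if ?dilation
    using assms that by (rule dilation_imp_unitary_conjugation)
  show ?dilation if ?unitary
    using assms that by (rule unitary_conjugation_imp_dilation)
qed

end
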